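(* Let $q$ be a prime power and $\varepsilon\in\{-1,+1\}$. Then, as formal power series in $x$, $$\Big(1+\sum_{n^-\geq1}\Big[\sum_{\lambda^-\vdash n^-}\prod_{d^-\in B(\lambda^-)}\binom{\varepsilon\,\mathrm{SRIM}^-_{d^-}(q)}{E(\lambda^-,d^-)}\Big]x^{n^-}\Big)\Big(1+\sum_{n^+\geq1}\Big[\sum_{\lambda^+\vdash n^+}\prod_{d^+\in B(\lambda^+)}\binom{\varepsilon\,\mathrm{SRIM}^+_{d^+}(q)}{-E(\lambda^+,d^+)}\Big]x^{n^+}\Big)=\Big(\frac{1}{1-x}\Big)^{\varepsilon}.$$
   Context: For $f(x)\in\mathbf{F}_q[x]$ of degree $d$ with $f(0)\neq0$, $f^*(x)=x^df(x^{-1})$ and $f$ is self-reciprocal if $f^*=f$. $\mathrm{SRIM}^-_d(q)$ is the number of self-reciprocal irreducible monic polynomials of degree $2d$ over $\mathbf{F}_q$; $\mathrm{SRIM}^+_d(q)$ is the number of unordered pairs $\{f,f^*/f(0)\}$ with $f$ irreducible monic of degree $d$ over $\mathbf{F}_q$, $f(0)\neq0$, $f\neq f^*/f(0)$. For a partition $\lambda$, $B(\lambda)$ is its set of distinct parts and $E(\lambda,d)$ the multiplicity of $d$. For $m\in\mathbf{Q}$ and $k\geq0$, $\binom{m}{k}=m(m-1)\cdots(m-k+1)/k!$ and $\binom{m}{-k}=(-1)^k\binom{m}{k}$. *)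

theory Defs
  imports
    "HOL-Computational_Algebra.Computational_Algebra"
    "HOL-Library.Multiset"
begin

text \<open>
  The finite field with \<open>q\<close> elements is a type \<^typ>\<open>'a :: {finite, field}\<close> with
  \<open>q = CARD('a)\<close>. For \<open>f(0) \<noteq> 0\<close> and \<open>d = degree f\<close>, \<^term>\<open>reflect_poly f\<close> is
  \<open>x\<^sup>d f(1/x)\<close> (see \<open>poly_reflect_poly_nz\<close>).
\<close>

definition self_reciprocal :: "'a :: field poly \<Rightarrow> bool" where
  "self_reciprocal f \<longleftrightarrow> poly f 0 \<noteq> 0 \<and> reflect_poly f = f"

definition monic_reciprocal :: "'a :: field poly \<Rightarrow> 'a poly" where
  "monic_reciprocal f = smult (inverse (poly f 0)) (reflect_poly f)"

definition SRIM_minus :: "'a :: {finite, field} itself \<Rightarrow> nat \<Rightarrow> nat" where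
  "SRIM_minus _ d =
     card {f :: 'a poly. irreducible f \<and> lead_coeff f = 1 \<and> degree f = 2 * d \<and> self_reciprocal f}"

definition SRIM_plus :: "'a :: {finite, field} itself \<Rightarrow> nat \<Rightarrow> nat" where
  "SRIM_plus _ d =
     card {{f, monic_reciprocal f} | f :: 'a poly.
             irreducible f \<and> lead_coeff f = 1 \<and> degree f = d \<and>
             poly f 0 \<noteq> 0 \<and> f \<noteq> monic_reciprocal f}"

text \<open>
  A partition is the multiset of its parts: \<open>B(\<mu>)\<close> is \<^term>\<open>set_mset \<mu>\<close> and
  \<open>E(\<mu>, d)\<close> is \<^term>\<open>count \<mu> d\<close>.
\<close>

definition partitions_of :: "nat \<Rightarrow> nat multiset set" where
  "partitions_of n = {\<mu>. 0 \<notin># \<mu> \<and> sum_mset \<mu> = n}"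

definition int_binomial :: "rat \<Rightarrow> int \<Rightarrow> rat" where
  "int_binomial m k =
     (if k \<ge> 0 then m gchoose nat k else (- 1) ^ nat (- k) * (m gchoose nat (- k)))"

lemma finite_partitions_of: "finite (partitions_of n)"
proof (induction n rule: less_induct)
  case (less n)
  let ?T = "insert {#} (\<Union>k\<in>{1..n}. add_mset k ` partitions_of (n - k))"
  have "partitions_of n \<subseteq> ?T"
  proof
    fix \<mu> assume l: "\<mu> \<in> partitions_of n"
    show "\<mu> \<in> ?T"
    proof (cases \<mu>)
      case (add k \<nu>)
      then have "k \<in> {1..n}" "\<nu> \<in> partitions_of (n - k)"
        using l by (auto simp: partitions_of_def)
      with add show ?thesis by blast
    qed simp
  qed
  moreover have "finite ?T" using less.IH by auto
  ultimately show ?case by (rule finite_subset)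
qed

lemma finite_polys_degree: "finite {f :: 'a :: {finite, field} poly. degree f = d}"
proof (rule finite_subset)
  show "{f :: 'a poly. degree f = d} \<subseteq> Poly ` {xs. set xs \<subseteq> UNIV \<and> length xs \<le> Suc d}"
  proof
    fix f :: "'a poly" assume "f \<in> {f. degree f = d}"
    then have "length (coeffs f) \<le> Suc d"
      by (cases "f = 0") (auto simp: length_coeffs_degree)
    then show "f \<in> Poly ` {xs. set xs \<subseteq> UNIV \<and> length xs \<le> Suc d}"
      by (intro image_eqI[of _ _ "coeffs f"]) auto
  qed
  show "finite (Poly ` {xs :: 'a list. set xs \<subseteq> UNIV \<and> length xs \<le> Suc d})"
    by (intro finite_imageI finite_lists_length_le) simp
qed

end

theory Submission
  imports Defs "HOL-Library.Cardinality"
begin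

text \<open>
  The two series are \<open>\<Prod>\<^sub>d (1 + x\<^sup>d) ^ (\<epsilon> N\<^sup>-\<^sub>d)\<close> and \<open>\<Prod>\<^sub>d (1 - x\<^sup>d) ^ (\<epsilon> N\<^sup>+\<^sub>d)\<close>, with
  \<open>N\<^sup>-\<^sub>d\<close>, \<open>N\<^sup>+\<^sub>d\<close> the two SRIM numbers. Comparing logarithmic derivatives, the claim becomes
  \<open>\<Sum>\<^bsub>d | n\<^esub> d ((-1) ^ (n/d + 1) N\<^sup>-\<^sub>d - N\<^sup>+\<^sub>d) = 1\<close> for all \<open>n \<ge> 1\<close>. This follows by subtracting the
  degrees of the squarefree polynomials \<open>X ^ (q\<^sup>n - 1) - 1\<close> and \<open>X ^ (q\<^sup>n + 1) - 1\<close>, each the product of its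
  monic irreducible divisors. An irreducible \<open>f \<noteq> X\<close> divides the first iff \<open>deg f\<close> divides \<open>n\<close>. It divides
  the second iff \<open>1/x = x ^ (q\<^sup>n)\<close> modulo \<open>f\<close>, that is, iff \<open>f\<close> equals its monic reciprocal and either is
  linear or has degree \<open>2d\<close> with \<open>n/d\<close> an odd integer. The self-conjugate linear factors occur in
  both products and cancel.
\<close>

section \<open>Partition sums and logarithmic derivatives\<close>

text \<open>Expanding the product picks a multiple of d as exponent from each factor, and the
  quotient by d is the multiplicity of the part d. The induction splits off one part size through
  the Cauchy product.\<close>

lemma fps_prod_nth_partitions:
  fixes f :: "nat \<Rightarrow> nat \<Rightarrow> 'b :: comm_ring_1"
  assumes "finite D" "0 \<notin> D" and f0: "\<And>d. f d 0 = 1"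
  shows "(\<Prod>d\<in>D. Abs_fps (\<lambda>m. if d dvd m then f d (m div d) else 0)) $ n =
         (\<Sum>\<mu> | set_mset \<mu> \<subseteq> D \<and> sum_mset \<mu> = n. \<Prod>d\<in>D. f d (count \<mu> d))"
  using assms(1,2)
proof (induction D arbitrary: n rule: finite_induct)
  case empty
  have "{\<mu> :: nat multiset. set_mset \<mu> \<subseteq> {} \<and> sum_mset \<mu> = n} = (if n = 0 then {{#}} else {})"
    by auto
  then show ?case by simp
next
  case (insert d D)
  define F where "F d = Abs_fps (\<lambda>m. if d dvd m then f d (m div d) else 0)" for d
  define Q where "Q D n = {\<mu> :: nat multiset. set_mset \<mu> \<subseteq> D \<and> sum_mset \<mu> = n}" for D n
  have d: "d > 0" and D: "0 \<notin> D" using insert.prems by (auto intro: gr0I)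
  have finQ: "finite (Q D n)" for n
    by (rule finite_subset[OF _ finite_partitions_of[of n]])
      (use D in \<open>auto simp: Q_def partitions_of_def\<close>)
  have IH: "(\<Prod>d\<in>D. F d) $ n = (\<Sum>\<mu>\<in>Q D n. \<Prod>e\<in>D. f e (count \<mu> e))" for n
    using insert.IH[OF D] by (simp add: F_def Q_def)
  define I where "I = {i \<in> {0..n}. d dvd i}"
  have "(\<Prod>d\<in>insert d D. F d) $ n = (\<Sum>i=0..n. F d $ i * (\<Prod>d\<in>D. F d) $ (n - i))"
    using insert.hyps by (simp add: fps_mult_nth)
  also have "\<dots> = (\<Sum>i\<in>I. f d (i div d) * (\<Prod>d\<in>D. F d) $ (n - i))"
    unfolding I_def by (rule sum.mono_neutral_cong_right) (auto simp: F_def)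
  also have "\<dots> = (\<Sum>i\<in>I. \<Sum>\<mu>\<in>Q D (n - i). f d (i div d) * (\<Prod>e\<in>D. f e (count \<mu> e)))"
    by (simp add: IH sum_distrib_left)
  also have "\<dots> = (\<Sum>(i, \<mu>)\<in>(SIGMA i:I. Q D (n - i)). f d (i div d) * (\<Prod>e\<in>D. f e (count \<mu> e)))"
    by (rule sum.Sigma) (auto simp: I_def finQ)
  \<comment> \<open>A pair (i, \<mu>) becomes the partition \<mu> with i div d parts d added.
    Conversely the parts d are removed and their total is recorded as i.\<close>
  also have "\<dots> = (\<Sum>\<mu>\<in>Q (insert d D) n. \<Prod>e\<in>insert d D. f e (count \<mu> e))"
  proof (rule sum.reindex_bij_witness[where
        j = "\<lambda>(i, \<mu>). \<mu> + replicate_mset (i div d) d" and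
        i = "\<lambda>\<mu>. (d * count \<mu> d, filter_mset (\<lambda>x. x \<noteq> d) \<mu>)"], goal_cases)
    case (1 a)
    then obtain i \<mu> where a: "a = (i, \<mu>)" "i \<in> I" "\<mu> \<in> Q D (n - i)" by auto
    have "d \<notin># \<mu>" using a insert.hyps by (auto simp: Q_def)
    then have "count \<mu> d = 0" "filter_mset (\<lambda>x. x \<noteq> d) \<mu> = \<mu>"
      by (auto simp: not_in_iff multiset_eq_iff)
    with a show ?case by (auto simp: I_def)
  next
    case (2 a)
    then obtain i \<mu> where a: "a = (i, \<mu>)" "i \<in> I" "\<mu> \<in> Q D (n - i)" by auto
    then show ?case by (auto simp: I_def Q_def)
  next
    case (3 \<mu>)
    have "filter_mset (\<lambda>x. x \<noteq> d) \<mu> + replicate_mset (count \<mu> d) d = \<mu>"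
      by (auto simp: multiset_eq_iff)
    with d show ?case by simp
  next
    case (4 \<mu>)
    have "filter_mset (\<lambda>x. x \<noteq> d) \<mu> + replicate_mset (count \<mu> d) d = \<mu>"
      by (auto simp: multiset_eq_iff)
    then have "sum_mset (filter_mset (\<lambda>x. x \<noteq> d) \<mu> + replicate_mset (count \<mu> d) d) = n"
      using 4 by (simp add: Q_def)
    then have "sum_mset (filter_mset (\<lambda>x. x \<noteq> d) \<mu>) + d * count \<mu> d = n"
      by (simp add: mult.commute)
    with 4 show ?case by (auto simp: I_def Q_def)
  next
    case (5 a)
    then obtain i \<mu> where a: "a = (i, \<mu>)" "i \<in> I" "\<mu> \<in> Q D (n - i)" by auto
    have "d \<notin># \<mu>" using a insert.hyps by (auto simp: Q_def)
    then have "count \<mu> d = 0" by (auto simp: not_in_iff)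
    moreover have "(\<Prod>e\<in>D. f e (count (\<mu> + replicate_mset (i div d) d) e)) = (\<Prod>e\<in>D. f e (count \<mu> e))"
      by (rule prod.cong) (use insert.hyps in auto)
    ultimately show ?case using insert.hyps a by simp
  qed
  finally show ?case by (simp add: F_def Q_def)
qed

text \<open>Parts of a partition of n are at most n, so a finite product up to any N \<ge> n has the
  right coefficient and infinite products are avoided. Absent parts contribute
  \<open>f d 0 = 1\<close>.\<close>

lemma partition_sum_eq_fps_prod_nth:
  fixes f :: "nat \<Rightarrow> nat \<Rightarrow> 'b :: comm_ring_1"
  assumes f0: "\<And>d. f d 0 = 1" and "n \<le> N"
  shows "(\<Sum>\<mu>\<in>partitions_of n. \<Prod>d\<in>set_mset \<mu>. f d (count \<mu> d)) =
         (\<Prod>d=1..N. Abs_fps (\<lambda>m. if d dvd m then f d (m div d) else 0)) $ n"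
proof -
  have part: "{\<mu>. set_mset \<mu> \<subseteq> {1..N} \<and> sum_mset \<mu> = n} = partitions_of n"
  proof (intro equalityI subsetI)
    fix \<mu> assume \<mu>: "\<mu> \<in> partitions_of n"
    have "d \<in> {1..N}" if "d \<in># \<mu>" for d
    proof -
      have "d \<le> n" using \<mu> that by (auto simp: partitions_of_def dest: multi_member_split)
      moreover have "d \<noteq> 0" using \<mu> that by (metis (mono_tags) mem_Collect_eq partitions_of_def)
      ultimately show ?thesis using \<open>n \<le> N\<close> by auto
    qed
    with \<mu> show "\<mu> \<in> {\<mu>. set_mset \<mu> \<subseteq> {1..N} \<and> sum_mset \<mu> = n}"
      by (auto simp: partitions_of_def)
  qed (auto simp: partitions_of_def)
  have "(\<Prod>d=1..N. Abs_fps (\<lambda>m. if d dvd m then f d (m div d) else 0)) $ n =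
        (\<Sum>\<mu>\<in>partitions_of n. \<Prod>d=1..N. f d (count \<mu> d))"
    unfolding part[symmetric] by (rule fps_prod_nth_partitions) (simp_all add: f0)
  also have "\<dots> = (\<Sum>\<mu>\<in>partitions_of n. \<Prod>d\<in>set_mset \<mu>. f d (count \<mu> d))"
  proof (rule sum.cong[OF refl])
    fix \<mu> assume "\<mu> \<in> partitions_of n"
    then have "set_mset \<mu> \<subseteq> {1..N}" using part by auto
    then show "(\<Prod>d=1..N. f d (count \<mu> d)) = (\<Prod>d\<in>set_mset \<mu>. f d (count \<mu> d))"
      by (intro prod.mono_neutral_right) (auto simp: f0 not_in_iff)
  qed
  finally show ?thesis by simp
qed

section \<open>Binomial series and their logarithmic derivatives\<close>

text \<open>The parameter s lets one definition serve both series: s = 1 for the first and s = -1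
  for the second, where the negative lower index of the binomial contributes (-1)^k.\<close>

definition binomial_factor :: "rat \<Rightarrow> rat \<Rightarrow> nat \<Rightarrow> rat fps" where
  "binomial_factor s c d = Abs_fps (\<lambda>m. if d dvd m then s ^ (m div d) * (c gchoose (m div d)) else 0)"

text \<open>The geometric expansion of c s d x^d / (1 + s x^d), which is x F'/F for F = (1 + s
  x^d)^c.\<close>

definition binomial_logderiv :: "rat \<Rightarrow> rat \<Rightarrow> nat \<Rightarrow> rat fps" where
  "binomial_logderiv s c d =
     Abs_fps (\<lambda>m. if m > 0 \<and> d dvd m then - c * of_nat d * (- s) ^ (m div d) else 0)"

lemma fps_one_plus_X_power_mult_nth:
  "((1 + fps_const s * fps_X ^ d) * F) $ m = F $ m + (if m < d then 0 else s * F $ (m - d))"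
  for F :: "'b :: comm_ring_1 fps"
  by (simp add: distrib_right mult.assoc fps_X_power_mult_nth)

text \<open>The factor is \<open>(1 + s x\<^sup>d)\<^sup>c\<close>; both sides become \<open>c s d x\<^sup>d (1 + s x\<^sup>d)\<^sup>c\<close>
  after multiplication by \<open>1 + s x\<^sup>d\<close>.\<close>

lemma XD_binomial_factor:
  assumes "d > 0"
  shows "fps_XD (binomial_factor s c d) = binomial_factor s c d * binomial_logderiv s c d"
proof -
  let ?u = "1 + fps_const s * fps_X ^ d :: rat fps"
  have "?u $ 0 = 1" using assms by simp
  then have u: "?u \<noteq> 0" by (metis fps_zero_nth zero_neq_one)
  have F: "?u * fps_XD (binomial_factor s c d) =
           fps_const (c * s * of_nat d) * fps_X ^ d * binomial_factor s c d"
  proof (rule fps_ext)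
    fix m
    show "(?u * fps_XD (binomial_factor s c d)) $ m =
          (fps_const (c * s * of_nat d) * fps_X ^ d * binomial_factor s c d) $ m"
    proof (cases "d dvd m")
      case False
      then have "\<not> d dvd m - d" if "d \<le> m" using that by (meson dvd_minus_self nat_dvd_not_less leD)
      with False show ?thesis unfolding fps_one_plus_X_power_mult_nth
        by (auto simp: binomial_factor_def mult.assoc fps_X_power_mult_nth)
    next
      case True
      then obtain k where k: "m = d * k" by auto
      show ?thesis
      proof (cases k)
        case 0
        then show ?thesis using k assms unfolding fps_one_plus_X_power_mult_nth
          by (simp add: binomial_factor_def mult.assoc fps_X_power_mult_nth)
      next
        case (Suc j)
        have m: "m - d = d * j" "\<not> m < d" "m div d = Suc j" "(m - d) div d = j" "d dvd m - d"
          using k Suc assms by auto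
        \<comment> \<open>This is the coefficient form of (1 + t) F' = c F for F = (1 +
          t)^c.\<close>
        have rec: "c * (c gchoose j) = of_nat j * (c gchoose j) + of_nat (Suc j) * (c gchoose Suc j)"
          by (rule gbinomial_mult_1)
        have mm: "of_nat m = (of_nat d * of_nat (Suc j) :: rat)" using k Suc by (simp add: algebra_simps)
        have "of_nat d * of_nat (Suc j) * (s ^ Suc j * (c gchoose Suc j)) +
              s * (of_nat d * of_nat j * (s ^ j * (c gchoose j))) =
              of_nat d * s ^ Suc j * (of_nat j * (c gchoose j) + of_nat (Suc j) * (c gchoose Suc j))"
          by (simp add: algebra_simps)
        also have "\<dots> = c * s * of_nat d * (s ^ j * (c gchoose j))"
          unfolding rec[symmetric] by (simp add: algebra_simps)
        finally show ?thesis unfolding fps_one_plus_X_power_mult_nth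
          using m True by (simp add: binomial_factor_def mult.assoc fps_X_power_mult_nth mm
              del: of_nat_Suc power_Suc)
      qed
    qed
  qed
  have M: "?u * binomial_logderiv s c d = fps_const (c * s * of_nat d) * fps_X ^ d"
  proof (rule fps_ext)
    fix m
    show "(?u * binomial_logderiv s c d) $ m = (fps_const (c * s * of_nat d) * fps_X ^ d) $ m"
    proof (cases "d dvd m")
      case False
      then have "\<not> d dvd m - d" if "d \<le> m" using that by (meson dvd_minus_self nat_dvd_not_less leD)
      with False show ?thesis unfolding fps_one_plus_X_power_mult_nth
        by (auto simp: binomial_logderiv_def)
    next
      case True
      then obtain k where k: "m = d * k" by auto
      consider "k = 0" | "k = 1" | j where "k = Suc (Suc j)" by (metis One_nat_def not0_implies_Suc)
      then show ?thesis
      proof cases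
        case 3
        have m: "m - d = d * Suc j" "\<not> m < d" "m div d = Suc (Suc j)" "(m - d) div d = Suc j"
          "d dvd m - d" "m > 0" "m - d > 0" "m \<noteq> d"
          using k 3 assms by auto
        show ?thesis unfolding fps_one_plus_X_power_mult_nth
          using m True by (simp add: binomial_logderiv_def)
      qed (use k assms in \<open>simp_all add: fps_one_plus_X_power_mult_nth binomial_logderiv_def\<close>)
    qed
  qed
  have "?u * fps_XD (binomial_factor s c d) = ?u * (binomial_factor s c d * binomial_logderiv s c d)"
    unfolding F M[symmetric] by (simp add: mult_ac)
  with u show ?thesis by (metis mult_left_cancel)
qed

section \<open>Recovering a series from its logarithmic derivative\<close>

lemma XD_one: "fps_XD (1 :: 'b :: comm_ring_1 fps) = 0"
  by (simp add: fps_XD_def)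

lemma XD_mult: "fps_XD (a * b) = fps_XD a * b + a * fps_XD b"
  for a b :: "'b :: comm_ring_1 fps"
  by (simp add: fps_XD_def algebra_simps)

lemma XD_prod_logderiv:
  fixes F M :: "'c \<Rightarrow> 'b :: comm_ring_1 fps"
  assumes "\<And>d. d \<in> D \<Longrightarrow> fps_XD (F d) = F d * M d"
  shows "fps_XD (prod F D) = prod F D * sum M D"
  using assms
  by (induction D rule: infinite_finite_induct) (simp_all add: XD_mult XD_one algebra_simps)

text \<open>The equation for G reads n G_n = \<Sum> G_i L_(n-i), and L_0 = 0 removes G_n from the
  right, so G_n is determined recursively. Only coefficients up to n enter, which is what makes
  truncated products sufficient.\<close>

lemma fps_nth_eq_if_same_logderiv:
  fixes G H :: "rat fps"
  assumes "fps_XD G = G * L" "fps_XD H = H * K" "G $ 0 = H $ 0" "L $ 0 = 0" "K $ 0 = 0"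
    and LK: "\<And>i. i \<le> n \<Longrightarrow> L $ i = K $ i"
  shows "G $ n = H $ n"
  using LK
proof (induction n rule: less_induct)
  case (less n)
  show ?case
  proof (cases "n = 0")
    case False
    have "of_nat n * G $ n = (\<Sum>i=0..n. G $ i * L $ (n - i))"
      using arg_cong[OF assms(1), of "\<lambda>F. F $ n"] by (simp add: fps_mult_nth)
    also have "\<dots> = (\<Sum>i=0..n. H $ i * K $ (n - i))"
    proof (rule sum.cong[OF refl])
      fix i assume "i \<in> {0..n}"
      then show "G $ i * L $ (n - i) = H $ i * K $ (n - i)"
        using less assms(4,5) by (cases "i = n") auto
    qed
    also have "\<dots> = of_nat n * H $ n"
      using arg_cong[OF assms(2), of "\<lambda>F. F $ n"] by (simp add: fps_mult_nth)
    finally show ?thesis using False by simp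
  qed (use assms(3) in simp)
qed

text \<open>Supplies the logarithmic derivative \<epsilon> x / (1 - x) of the right-hand side,
  computed from the geometric series for \<epsilon> = 1 and from 1 - x for \<epsilon> = -1.\<close>

lemma XD_geometric_powi:
  fixes \<epsilon> :: int
  assumes "\<epsilon> \<in> {-1, 1}"
  defines "H \<equiv> (1 / (1 - fps_X)) powi \<epsilon> :: rat fps"
  shows "fps_XD H = H * Abs_fps (\<lambda>n. if n > 0 then of_int \<epsilon> else 0)" and "H $ 0 = 1"
proof -
  have inv: "inverse (1 - fps_X) = (Abs_fps (\<lambda>_. 1) :: rat fps)"
    using fps_inverse_gp'[where ?'a = rat] by (metis fps_inverse_idempotent fps_nth_Abs_fps one_neq_zero)
  have geo: "1 / (1 - fps_X) = (Abs_fps (\<lambda>_. 1) :: rat fps)"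
    by (simp add: fps_divide_unit inv)
  consider "\<epsilon> = 1" | "\<epsilon> = -1" using assms by auto
  then have "fps_XD H = H * Abs_fps (\<lambda>n. if n > 0 then of_int \<epsilon> else 0) \<and> H $ 0 = 1"
  proof cases
    case 1
    have "(\<Sum>i=0..n. if i < n then 1 else 0) = (of_nat n :: rat)" for n
    proof -
      have "(\<Sum>i=0..n. if i < n then 1 else 0) = (\<Sum>i\<in>{0..<n}. 1 :: rat)"
        by (rule sum.mono_neutral_cong_right) auto
      then show ?thesis by simp
    qed
    then show ?thesis
      unfolding H_def 1 of_int_1 geo by (simp add: fps_eq_iff fps_mult_nth)
  next
    case 2
    have "H = 1 - fps_X"
      using 2 by (simp add: H_def geo power_int_minus fps_inverse_gp')
    moreover have "fps_XD (1 - fps_X) =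
        (1 - fps_X) * Abs_fps (\<lambda>n. if n > 0 then of_int \<epsilon> else (0 :: rat))"
      unfolding 2 by (auto simp: fps_eq_iff left_diff_distrib)
    ultimately show ?thesis by simp
  qed
  then show "fps_XD H = H * Abs_fps (\<lambda>n. if n > 0 then of_int \<epsilon> else 0)" "H $ 0 = 1" by auto
qed

section \<open>The Frobenius map on polynomials over a finite field\<close>

lemma card_field_gt_1: "1 < CARD('a :: {finite, field})"
proof -
  have "card {0, 1 :: 'a} \<le> CARD('a)" by (rule card_mono) auto
  then show ?thesis by simp
qed

text \<open>Multiplication by a nonzero x permutes the nonzero elements, whose product can then be
  cancelled.\<close>

lemma field_power_card: "x ^ CARD('a) = x" for x :: "'a :: {finite, field}"
proof (cases "x = 0")
  case False
  let ?U = "UNIV - {0 :: 'a}"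
  have "(\<Prod>y\<in>?U. x * y) = \<Prod>?U"
    by (rule prod.reindex_bij_witness[of _ "\<lambda>y. y / x" "\<lambda>y. x * y"]) (use False in auto)
  then have "x ^ card ?U * \<Prod>?U = \<Prod>?U" by (simp add: prod.distrib)
  then have "x ^ card ?U = 1" by simp
  moreover have "CARD('a) = Suc (card ?U)" by (simp add: card_Suc_Diff1)
  ultimately show ?thesis by (metis mult.right_neutral power_Suc)
qed simp

text \<open>\<open>(X + 1)\<^sup>q - X\<^sup>q - 1\<close> has degree less than \<open>q\<close> and vanishes on the whole field.\<close>

lemma of_nat_card_choose:
  assumes "0 < k" "k < CARD('a :: {finite, field})"
  shows "of_nat (CARD('a) choose k) = (0 :: 'a)"
proof -
  let ?q = "CARD('a)"
  define P :: "'a poly" where "P = (\<Sum>k\<in>{1..<?q}. monom (of_nat (?q choose k)) k)"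
  have deg: "degree P < ?q"
    unfolding P_def by (rule degree_sum_less)
      (use card_field_gt_1[where 'a = 'a] in \<open>auto intro: le_less_trans[OF degree_monom_le]\<close>)
  have "poly P a = poly 0 a" for a
  proof -
    have "{..?q} = insert 0 (insert ?q {1..<?q})" by auto
    then have "(a + 1) ^ ?q = a ^ ?q + 1 + poly P a"
      using card_field_gt_1[where 'a = 'a]
      by (subst binomial_ring) (simp add: P_def poly_sum poly_monom)
    then show ?thesis by (simp add: field_power_card)
  qed
  then have "P = 0"
    by (intro poly_eqI_degree[of UNIV]) (use deg in auto)
  moreover have "coeff P k = of_nat (?q choose k)"
    using assms by (simp add: P_def coeff_sum)
  ultimately show ?thesis by simp
qed

lemma of_nat_card_field: "of_nat CARD('a) = (0 :: 'a :: {finite, field})"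
  using of_nat_card_choose[of 1, where 'a = 'a] card_field_gt_1[where 'a = 'a] by simp

text \<open>The inner binomial coefficients vanish by \<open>of_nat_card_choose\<close>, which gives
  the q-th power; iteration gives the rest.\<close>

lemma frobenius_add:
  fixes u v :: "'a :: {finite, field} poly"
  shows "(u + v) ^ (CARD('a) ^ n) = u ^ (CARD('a) ^ n) + v ^ (CARD('a) ^ n)"
proof (induction n)
  case (Suc n)
  let ?q = "CARD('a)"
  have step: "(u + v) ^ ?q = u ^ ?q + v ^ ?q" for u v :: "'a poly"
  proof -
    have "(u + v) ^ ?q = (\<Sum>k\<le>?q. of_nat (?q choose k) * u ^ k * v ^ (?q - k))"
      by (rule binomial_ring)
    also have "\<dots> = (\<Sum>k\<in>{0, ?q}. of_nat (?q choose k) * u ^ k * v ^ (?q - k))"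
      by (rule sum.mono_neutral_right) (auto simp: of_nat_poly of_nat_card_choose)
    finally show ?thesis using card_field_gt_1[where 'a = 'a] by simp
  qed
  show ?case by (simp add: Suc step power_mult mult.commute[of ?q])
qed simp

lemma frobenius_diff:
  fixes u v :: "'a :: {finite, field} poly"
  shows "(u - v) ^ (CARD('a) ^ n) = u ^ (CARD('a) ^ n) - v ^ (CARD('a) ^ n)"
  using frobenius_add[of "u - v" v n] by simp

lemma field_power_card_power: "x ^ (CARD('a) ^ n) = x" for x :: "'a :: {finite, field}"
  by (induction n) (simp_all add: field_power_card power_mult)

lemma monom_1_0: "monom 1 0 = (1 :: 'a :: comm_semiring_1 poly)"
  by (simp add: monom_0)

lemma monom_1_power: "monom 1 m ^ n = (monom 1 (m * n) :: 'a :: comm_semiring_1 poly)"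
  by (simp add: monom_power)

lemma pCons_eq_monom: "pCons a p = [:a:] + monom 1 1 * p"
  for p :: "'a :: comm_semiring_1 poly"
  by (simp add: monom_altdef)

text \<open>The q-power map is additive and fixes the coefficients, so it acts on X alone.
  Consequently x^(q^n) is a root of f modulo f for every n.\<close>

lemma frobenius_eq_pcompose:
  fixes g :: "'a :: {finite, field} poly"
  shows "g ^ (CARD('a) ^ n) = pcompose g (monom 1 (CARD('a) ^ n))"
proof (induction g)
  case 0
  show ?case by (simp add: power_0_left)
next
  case (pCons a g)
  have "pcompose (monom 1 1) u = u" for u :: "'a poly"
    by (simp add: monom_altdef pcompose_pCons)
  then show ?case
    unfolding pCons_eq_monom[of a g] frobenius_add pcompose_add pcompose_mult power_mult_distrib pCons.IH
    by (simp add: monom_1_power poly_const_pow field_power_card_power)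
qed

lemma dvd_pcompose_diff: "f dvd u - v \<Longrightarrow> f dvd pcompose g u - pcompose g v"
  for f g :: "'a :: comm_ring_1 poly"
proof (induction g)
  case (pCons a g)
  have "pcompose (pCons a g) u - pcompose (pCons a g) v =
        (u - v) * pcompose g u + v * (pcompose g u - pcompose g v)"
    by (simp add: pcompose_pCons algebra_simps)
  with pCons show ?case by simp
qed simp

section \<open>Counting residues and roots modulo an irreducible polynomial\<close>

text \<open>Such polynomials represent the residues modulo a polynomial of degree m. For m = 0 the
  set is empty while the power is 1.\<close>

lemma card_polys_degree_less:
  assumes "m > 0"
  shows "card {g :: 'a :: {finite, field} poly. degree g < m} = CARD('a) ^ m"
proof -
  have "bij_betw (\<lambda>g. map (coeff g) [0..<m]) {g :: 'a poly. degree g < m}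
          {xs. set xs \<subseteq> UNIV \<and> length xs = m}"
  proof (rule bij_betw_byWitness[where f' = Poly])
    show "\<forall>g\<in>{g :: 'a poly. degree g < m}. Poly (map (coeff g) [0..<m]) = g"
      by (auto simp: poly_eq_iff nth_default_def coeff_eq_0)
    show "\<forall>xs\<in>{xs :: 'a list. set xs \<subseteq> UNIV \<and> length xs = m}. map (coeff (Poly xs)) [0..<m] = xs"
      by (auto intro!: nth_equalityI simp: nth_default_def)
    show "Poly ` {xs :: 'a list. set xs \<subseteq> UNIV \<and> length xs = m} \<subseteq> {g. degree g < m}"
    proof clarsimp
      fix xs :: "'a list" assume "m = length xs"
      then show "degree (Poly xs) < length xs"
        using assms by (intro degree_lessI) (auto simp: nth_default_def)
    qed
  qed auto
  then have "card {g :: 'a poly. degree g < m} = card {xs :: 'a list. set xs \<subseteq> UNIV \<and> length xs = m}"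
    by (rule bij_betw_same_card)
  also have "\<dots> = CARD('a) ^ m" by (rule card_lists_length_eq) simp
  finally show ?thesis .
qed

lemma finite_polys_degree_less: "finite {g :: 'a :: {finite, field} poly. degree g < m}"
proof -
  have "{g :: 'a poly. degree g < m} = (\<Union>d<m. {g. degree g = d})" by auto
  then show ?thesis by (simp add: finite_polys_degree)
qed

text \<open>Division by X - a for one root a leaves a quotient with the same leading coefficient
  that vanishes modulo p at every other root b, since the prime p does not divide b - a. This is the
  usual root bound over the quotient by p, phrased by divisibility.\<close>

lemma card_roots_mod_prime_elem_le:
  fixes p :: "'a :: idom"
  assumes "prime_elem p" "\<not> p dvd lead_coeff P" "finite A"
    "\<And>a. a \<in> A \<Longrightarrow> p dvd poly P a"
    "\<And>a b. a \<in> A \<Longrightarrow> b \<in> A \<Longrightarrow> a \<noteq> b \<Longrightarrow> \<not> p dvd a - b"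
  shows "card A \<le> degree P"
  using assms(2-)
proof (induction "degree P" arbitrary: P A)
  case 0
  then obtain c where "P = [:c:]" by (metis degree_eq_zeroE)
  with 0 have "A = {}" by auto
  then show ?case by simp
next
  case (Suc n)
  show ?case
  proof (cases "A = {}")
    case False
    then obtain a where a: "a \<in> A" by auto
    define Q where "Q = synthetic_div P a"
    have P: "P = [:-a, 1:] * Q + [:poly P a:]"
      unfolding Q_def by (rule synthetic_div_correct'[symmetric])
    have dQ: "degree Q = n" using Suc(2) by (simp add: Q_def degree_synthetic_div)
    have "coeff P (Suc n) = coeff Q n"
      using dQ by (subst P) (simp add: coeff_eq_0)
    then have "lead_coeff P = coeff Q n" using Suc(2) by simp
    then have "\<not> p dvd lead_coeff Q" using Suc.prems dQ by simp
    moreover have "p dvd poly Q b" if "b \<in> A - {a}" for b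
    proof -
      have "poly P b = (b - a) * poly Q b + poly P a" by (subst P) (simp add: algebra_simps)
      then have "p dvd (b - a) * poly Q b"
        using Suc.prems(3)[OF a] Suc.prems(3)[of b] that by (metis DiffD1 dvd_add_left_iff)
      then show ?thesis
        using assms(1) Suc.prems(4)[of b a] that a by (auto simp: prime_elem_dvd_mult_iff)
    qed
    ultimately have "card (A - {a}) \<le> degree Q"
      using Suc.prems dQ by (intro Suc.hyps(1)) auto
    then show ?thesis using dQ Suc(2) a Suc.prems(2) by (simp add: card_Diff_singleton)
  qed simp
qed

section \<open>Irreducible divisors of \<open>X\<^sup>N - 1\<close>\<close>

lemma degree_pos_if_irreducible: "irreducible f \<Longrightarrow> 0 < degree f" for f :: "'a :: field poly"
  by (metis gr0I irreducible_def is_unit_iff_degree)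

lemma not_dvd_if_degree_less: "g \<noteq> 0 \<Longrightarrow> degree g < degree f \<Longrightarrow> \<not> f dvd g"
  for f g :: "'a :: field poly"
  using dvd_imp_degree_le[of f g] by auto

text \<open>Fermat's argument in the residue field of f: multiplication by x permutes the nonzero
  residues, and comparing products shows that x^(q^m - 1) is 1 modulo f, where m is the degree. The
  case where f divides X is immediate.\<close>

lemma irreducible_dvd_X_power_card_degree:
  fixes f :: "'a :: {finite, field} poly"
  assumes irr: "irreducible f"
  shows "f dvd monom 1 (CARD('a) ^ degree f) - monom 1 1"
proof (cases "f dvd monom 1 1")
  case True
  then have "f dvd monom 1 1 * monom 1 (CARD('a) ^ degree f - 1)" by (rule dvd_mult2)
  also have "monom 1 1 * monom 1 (CARD('a) ^ degree f - 1) = monom (1::'a) (CARD('a) ^ degree f)"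
    by (simp add: mult_monom)
  finally show ?thesis using True by (rule dvd_diff)
next
  case False
  let ?m = "degree f" and ?x = "monom 1 1 :: 'a poly"
  have prime: "prime_elem f" by (rule field_poly_irreducible_imp_prime[OF irr])
  have m: "?m > 0" by (rule degree_pos_if_irreducible[OF irr])
  define R where "R = {g :: 'a poly. degree g < ?m} - {0}"
  have cardR: "card R = CARD('a) ^ ?m - 1" "finite R"
  proof -
    show "card R = CARD('a) ^ ?m - 1" "finite R"
      using finite_polys_degree_less[of ?m, where 'a = 'a] card_polys_degree_less[OF m, where 'a = 'a] m by (simp_all add: R_def)
  qed
  have R: "\<not> f dvd g" if "g \<in> R" for g
    using that not_dvd_if_degree_less[of g f] by (auto simp: R_def)
  have notdvd: "\<not> f dvd ?x * g" if "g \<in> R" for g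
    using R[OF that] False prime by (simp add: prime_elem_dvd_mult_iff)
  have "bij_betw (\<lambda>g. (?x * g) mod f) R R"
  proof -
    have "(\<lambda>g. (?x * g) mod f) ` R \<subseteq> R"
    proof clarify
      fix g assume g: "g \<in> R"
      have "(?x * g) mod f \<noteq> 0" using notdvd[OF g] by (simp add: mod_eq_0_iff_dvd)
      then show "(?x * g) mod f \<in> R"
        using degree_mod_less'[of f "?x * g"] irr by (auto simp: R_def irreducible_def)
    qed
    moreover have "inj_on (\<lambda>g. (?x * g) mod f) R"
    proof (rule inj_onI)
      fix g h assume gh: "g \<in> R" "h \<in> R" "(?x * g) mod f = (?x * h) mod f"
      then have "f dvd ?x * (g - h)" by (simp add: mod_eq_dvd_iff right_diff_distrib)
      then have "f dvd g - h" using False prime by (simp add: prime_elem_dvd_mult_iff)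
      moreover have "degree (g - h) < ?m" using gh by (auto simp: R_def intro: degree_diff_less)
      ultimately show "g = h" using not_dvd_if_degree_less[of "g - h" f] by auto
    qed
    ultimately show ?thesis using cardR(2) by (simp add: bij_betw_def endo_inj_surj)
  qed
  then have perm: "(\<Prod>g\<in>R. (?x * g) mod f) = \<Prod>R" by (rule prod.reindex_bij_betw)
  \<comment> \<open>Reducing every factor modulo f does not change the product modulo f.\<close>
  have "f dvd (\<Prod>g\<in>S. ?x * g) - (\<Prod>g\<in>S. (?x * g) mod f)" if "finite S" for S
    using that
  proof (induction S rule: finite_induct)
    case (insert g S)
    have "(\<Prod>g\<in>insert g S. ?x * g) - (\<Prod>g\<in>insert g S. (?x * g) mod f) =
      (?x * g - (?x * g) mod f) * (\<Prod>g\<in>S. ?x * g) +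
      (?x * g) mod f * ((\<Prod>g\<in>S. ?x * g) - (\<Prod>g\<in>S. (?x * g) mod f))"
      using insert.hyps by (simp add: algebra_simps)
    moreover have "f dvd ?x * g - (?x * g) mod f" by (simp add: dvd_minus_mod)
    ultimately show ?case using insert.IH by (metis dvd_add dvd_mult dvd_mult2)
  qed simp
  from this[OF cardR(2)] have "f dvd (?x ^ card R - 1) * \<Prod>R"
    unfolding perm by (simp add: prod.distrib algebra_simps)
  moreover have "\<not> f dvd \<Prod>R"
    using cardR(2) R
    by (induction R rule: finite_induct)
      (use prime in \<open>auto simp: prime_elem_dvd_mult_iff prime_elem_not_unit\<close>)
  ultimately have "f dvd ?x ^ card R - 1" using prime by (simp add: prime_elem_dvd_mult_iff)
  \<comment> \<open>The zero residue is not in R, so one factor x raises the exponent from q^m - 1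
    to q^m.\<close>
  then have "f dvd ?x * (?x ^ card R - 1)" by (rule dvd_mult)
  also have "?x * (?x ^ card R - 1) = monom 1 (CARD('a) ^ ?m) - monom 1 1"
    by (simp add: cardR monom_1_power mult_monom right_diff_distrib)
  finally show ?thesis .
qed

text \<open>If x^(q^k) is x modulo f, then g^(q^k) = g(x^(q^k)) is g modulo f for every residue g.
  All q^m residues are then roots of one polynomial of degree q^k.\<close>

lemma degree_le_if_dvd_X_power_card:
  fixes f :: "'a :: {finite, field} poly"
  assumes irr: "irreducible f" and k: "k > 0" and dvd: "f dvd monom 1 (CARD('a) ^ k) - monom 1 1"
  shows "degree f \<le> k"
proof -
  let ?q = "CARD('a)" and ?m = "degree f"
  have q: "?q > 1" by (rule card_field_gt_1)
  have qk: "?q ^ k > 1" using q k by (rule one_less_power)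
  have m: "?m > 0" by (rule degree_pos_if_irreducible[OF irr])
  \<comment> \<open>This is Y^(q^k) - Y in a new variable Y, to be evaluated at residues modulo
    f.\<close>
  define P :: "'a poly poly" where "P = monom 1 (?q ^ k) - monom 1 1"
  have degP: "degree P = ?q ^ k"
    unfolding P_def diff_conv_add_uminus
    by (subst degree_add_eq_left) (use qk in \<open>auto simp: degree_monom_eq\<close>)
  have "card {g :: 'a poly. degree g < ?m} \<le> degree P"
  proof (rule card_roots_mod_prime_elem_le[where p = f])
    show "prime_elem f" by (rule field_poly_irreducible_imp_prime[OF irr])
    have "coeff P (?q ^ k) = 1" using qk by (simp add: P_def)
    then show "\<not> f dvd lead_coeff P" using irr degP by (simp add: irreducible_not_unit)
    show "finite {g :: 'a poly. degree g < ?m}" by (rule finite_polys_degree_less)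
  next
    fix g :: "'a poly"
    have "f dvd pcompose g (monom 1 (?q ^ k)) - pcompose g (monom 1 1)"
      by (rule dvd_pcompose_diff[OF dvd])
    then show "f dvd poly P g"
      by (simp add: P_def poly_monom frobenius_eq_pcompose monom_altdef[of _ "Suc 0"])
  next
    fix g h :: "'a poly"
    assume "g \<in> {g. degree g < ?m}" "h \<in> {g. degree g < ?m}" "g \<noteq> h"
    then show "\<not> f dvd g - h"
      by (intro not_dvd_if_degree_less) (auto intro: degree_diff_less)
  qed
  then have "?q ^ ?m \<le> ?q ^ k" using card_polys_degree_less[OF m, where 'a = 'a] degP by simp
  then show ?thesis using q by simp
qed

lemma X_power_card_add_diff:
  "monom 1 (CARD('a) ^ (a + b)) - monom 1 (CARD('a) ^ b) =
   (monom 1 (CARD('a) ^ a) - monom 1 1 :: 'a :: {finite, field} poly) ^ (CARD('a) ^ b)"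
  by (simp add: frobenius_diff monom_1_power power_add)

text \<open>Adding a multiple of the degree m to k does not affect the divisibility, so k may be
  replaced by k mod m. A positive remainder below m would contradict
  \<open>degree_le_if_dvd_X_power_card\<close>.\<close>

lemma dvd_X_power_card_iff:
  fixes f :: "'a :: {finite, field} poly"
  assumes irr: "irreducible f"
  shows "f dvd monom 1 (CARD('a) ^ k) - monom 1 1 \<longleftrightarrow> degree f dvd k"
proof -
  let ?D = "\<lambda>k. monom 1 (CARD('a) ^ k) - monom 1 1 :: 'a poly"
  let ?m = "degree f"
  have prime: "prime_elem f" by (rule field_poly_irreducible_imp_prime[OF irr])
  have add: "f dvd ?D (a + b) \<longleftrightarrow> f dvd ?D a" if "f dvd ?D b" for a b
  proof -
    have "?D (a + b) = ?D a ^ (CARD('a) ^ b) + ?D b"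
      unfolding X_power_card_add_diff[of a b, where 'a = 'a, symmetric] by simp
    then have "f dvd ?D (a + b) \<longleftrightarrow> f dvd ?D a ^ (CARD('a) ^ b)"
      using that by (metis dvd_add_left_iff)
    also have "\<dots> \<longleftrightarrow> f dvd ?D a"
      using prime by (simp add: prime_elem_dvd_power_iff)
    finally show ?thesis .
  qed
  have mult: "f dvd ?D (j * ?m)" for j
  proof (induction j)
    case (Suc j)
    then show ?case using add[of "j * ?m" ?m] irreducible_dvd_X_power_card_degree[OF irr] 
      by (metis mult_Suc)
  qed simp
  have "f dvd ?D k \<longleftrightarrow> f dvd ?D (k mod ?m)"
    using add[OF mult, of "k mod ?m" "k div ?m"] by simp
  also have "\<dots> \<longleftrightarrow> k mod ?m = 0"
  proof
    assume "f dvd ?D (k mod ?m)"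
    then show "k mod ?m = 0"
      using degree_le_if_dvd_X_power_card[OF irr, of "k mod ?m"] degree_pos_if_irreducible[OF irr]
      by (metis gr0I leD mod_less_divisor)
  qed simp
  finally show ?thesis by (simp add: mod_eq_0_iff_dvd)
qed

lemma dvd_X_power_card_diff_iff:
  fixes f :: "'a :: {finite, field} poly"
  assumes irr: "irreducible f" and "i \<le> j"
  shows "f dvd monom 1 (CARD('a) ^ j) - monom 1 (CARD('a) ^ i) \<longleftrightarrow> degree f dvd j - i"
proof -
  have "monom 1 (CARD('a) ^ j) - monom 1 (CARD('a) ^ i) =
        (monom 1 (CARD('a) ^ (j - i)) - monom 1 1 :: 'a poly) ^ (CARD('a) ^ i)"
    using X_power_card_add_diff[of "j - i" i, where 'a = 'a] \<open>i \<le> j\<close> by simp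
  moreover have "f dvd g ^ (CARD('a) ^ i) \<longleftrightarrow> f dvd g" for g
    using field_poly_irreducible_imp_prime[OF irr] by (simp add: prime_elem_dvd_power_iff)
  ultimately show ?thesis by (simp only: dvd_X_power_card_iff[OF irr])
qed

section \<open>Squarefree polynomials and their monic irreducible divisors\<close>

lemma irreducible_smultI:
  fixes p :: "'a :: field poly"
  assumes "irreducible p" "c \<noteq> 0"
  shows "irreducible (smult c p)"
proof (rule irreducibleI)
  fix a b assume "smult c p = a * b"
  then have "p = smult (inverse c) a * b"
    using assms(2) by (metis left_inverse mult_smult_left smult_1_left smult_smult)
  then have "is_unit (smult (inverse c) a) \<or> is_unit b" using assms(1) by (rule irreducibleD[rotated])
  then show "is_unit a \<or> is_unit b" using assms(2) by (simp add: is_unit_smult_iff dvd_field_iff)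
next
  show "smult c p \<noteq> 0" using assms by auto
  show "\<not> is_unit (smult c p)" using assms by (simp add: is_unit_smult_iff irreducible_not_unit)
qed

lemma exists_monic_irreducible_dvd:
  fixes P :: "'a :: field poly"
  assumes "degree P > 0"
  shows "\<exists>f. irreducible f \<and> lead_coeff f = 1 \<and> f dvd P"
  using assms
proof (induction "degree P" arbitrary: P rule: less_induct)
  case less
  then have P0: "P \<noteq> 0" by auto
  show ?case
  proof (cases "irreducible P")
    case True
    let ?f = "smult (inverse (lead_coeff P)) P"
    have "irreducible ?f" using True P0 by (intro irreducible_smultI) auto
    then show ?thesis using P0 by (intro exI[of _ ?f]) (auto simp: smult_dvd)
  next
    case False
    then obtain a b where ab: "P = a * b" "\<not> is_unit a" "\<not> is_unit b"
      using P0 less.prems by (auto simp: irreducible_def is_unit_iff_degree)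
    then have "a \<noteq> 0" "b \<noteq> 0" "degree a > 0" "degree b > 0"
      using P0 by (auto simp: is_unit_iff_degree)
    then show ?thesis using less.hyps[of a] ab by (auto simp: degree_mult_eq)
  qed
qed

lemma monic_irreducible_dvd_eq:
  fixes f g :: "'a :: field poly"
  assumes "irreducible f" "irreducible g" "lead_coeff f = 1" "lead_coeff g = 1" "f dvd g"
  shows "f = g"
proof -
  obtain h where h: "g = f * h" using assms(5) by auto
  then have "is_unit h" using assms(1,2) by (metis irreducible_def)
  then obtain c where "h = [:c:]" using is_unit_polyE by blast
  moreover have "lead_coeff h = 1" using h assms(3,4) by (simp add: lead_coeff_mult)
  ultimately show ?thesis using h by simp
qed

text \<open>One monic irreducible divisor is split off at a time; squarefreeness keeps it from
  dividing the cofactor, so each degree is counted once.\<close>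

lemma degree_eq_sum_monic_irreducible_divisors:
  fixes P :: "'a :: field poly"
  assumes "P \<noteq> 0" "\<And>g. irreducible g \<Longrightarrow> \<not> g ^ 2 dvd P"
  defines "I \<equiv> {f. irreducible f \<and> lead_coeff f = 1 \<and> f dvd P}"
  shows "finite I \<and> degree P = (\<Sum>f\<in>I. degree f)"
  using assms(1,2) unfolding I_def
proof (induction "degree P" arbitrary: P rule: less_induct)
  case less
  let ?I = "\<lambda>P. {f :: 'a poly. irreducible f \<and> lead_coeff f = 1 \<and> f dvd P}"
  show ?case
  proof (cases "degree P = 0")
    case True
    have "f \<notin> ?I P" for f
      using True less.prems(1) degree_pos_if_irreducible[of f] dvd_imp_degree_le[of f P] by auto
    then have "?I P = {}" by blast
    then show ?thesis using True by (simp only: finite.emptyI sum.empty)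
  next
    case False
    then obtain g where g: "irreducible g" "lead_coeff g = 1" "g dvd P"
      using exists_monic_irreducible_dvd[of P] by auto
    then obtain Q where Q: "P = g * Q" by auto
    have Q0: "Q \<noteq> 0" and g0: "g \<noteq> 0" using less.prems(1) Q by auto
    have degP: "degree P = degree g + degree Q" using Q Q0 g0 by (simp add: degree_mult_eq)
    have "finite (?I Q) \<and> degree Q = (\<Sum>f\<in>?I Q. degree f)"
    proof (rule less.hyps)
      show "degree Q < degree P" using degP degree_pos_if_irreducible[OF g(1)] by simp
      show "\<not> h ^ 2 dvd Q" if "irreducible h" for h
        using less.prems(2)[OF that] Q by auto
    qed (rule Q0)
    moreover have "g \<notin> ?I Q"
      using less.prems(2)[OF g(1)] Q by (auto simp: power2_eq_square)
    moreover have "?I P = insert g (?I Q)"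
    proof -
      have "f \<in> ?I P \<longleftrightarrow> f = g \<or> f \<in> ?I Q" for f
        using g field_poly_irreducible_imp_prime[of f] monic_irreducible_dvd_eq[of f g]
        by (auto simp: Q prime_elem_dvd_mult_iff)
      then show ?thesis by blast
    qed
    ultimately show ?thesis using degP by simp
  qed
qed

text \<open>If g^2 divided X^N - 1, then g would divide the derivative N X^(N-1), hence X^N because
  N is invertible, and therefore 1.\<close>

lemma degree_sum_divisors_X_power_minus_1:
  assumes N: "N > 0" "of_nat N \<noteq> (0 :: 'a)"
  defines "I \<equiv> {f :: 'a :: field poly. irreducible f \<and> lead_coeff f = 1 \<and> f dvd monom 1 N - 1}"
  shows "finite I" "(\<Sum>f\<in>I. degree f) = N"
proof -
  let ?P = "monom 1 N - 1 :: 'a poly"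
  have deg: "degree ?P = N"
    unfolding diff_conv_add_uminus using N(1) by (subst degree_add_eq_left) (auto simp: degree_monom_eq)
  have "\<not> g ^ 2 dvd ?P" if g: "irreducible g" for g
  proof
    assume "g ^ 2 dvd ?P"
    then obtain h where h: "?P = g * (g * h)" by (metis dvdE mult.assoc power2_eq_square)
    then have "pderiv ?P = g * (pderiv (g * h) + pderiv g * h)"
      by (simp only: pderiv_mult) (simp add: algebra_simps)
    then have "g dvd pderiv ?P" by simp
    then have "g dvd monom (of_nat N) (N - 1)" by (simp add: pderiv_diff pderiv_monom)
    then have "g dvd monom (of_nat N) (N - 1) * monom (inverse (of_nat N)) 1" by (rule dvd_mult2)
    then have "g dvd monom 1 N" using N by (simp add: mult_monom)
    moreover have "g dvd ?P" using h by simp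
    ultimately have "g dvd monom 1 N - ?P" by (rule dvd_diff)
    then show False using g by (simp add: irreducible_not_unit)
  qed
  moreover have "?P \<noteq> 0" using deg N(1) by auto
  ultimately show "finite I" "(\<Sum>f\<in>I. degree f) = N"
    using degree_eq_sum_monic_irreducible_divisors[of ?P] deg unfolding I_def by auto
qed

section \<open>Self-conjugate irreducible polynomials\<close>

text \<open>The condition at 0 removes only X and leaves the set on which
  \<open>monic_reciprocal\<close> is an involution.\<close>

definition monic_irreducibles :: "'a :: field poly set" where
  "monic_irreducibles = {f. irreducible f \<and> lead_coeff f = 1 \<and> poly f 0 \<noteq> 0}"

lemma monic_irreduciblesD:
  assumes "f \<in> monic_irreducibles"
  shows "irreducible f" "prime_elem f" "lead_coeff f = 1" "poly f 0 \<noteq> 0" "coeff f 0 \<noteq> 0" "degree f > 0"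
  using assms degree_pos_if_irreducible[of f] field_poly_irreducible_imp_prime[of f]
  by (auto simp: monic_irreducibles_def poly_0_coeff_0)

text \<open>Makes x invertible modulo f, so that powers of x can be cancelled in later
  divisibilities. A prime f dividing a power of X would divide X; then X would divide the cofactor
  and f would be a unit.\<close>

lemma monic_irreducible_not_dvd_monom:
  fixes f :: "'a :: field poly"
  assumes "f \<in> monic_irreducibles"
  shows "\<not> f dvd monom 1 n"
proof
  assume "f dvd monom 1 n"
  then have "f dvd monom 1 1 ^ n" by (simp add: monom_1_power)
  then have "f dvd monom 1 1" using monic_irreduciblesD(2)[OF assms] prime_elem_dvd_power by blast
  then obtain h where h: "monom 1 1 = f * h" by auto
  then have "poly f 0 * poly h 0 = 0" by (metis poly_mult poly_monom power_one_right mult_zero_right)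
  then have "[:0, 1:] dvd h" using monic_irreduciblesD(4)[OF assms] poly_eq_0_iff_dvd[of h 0] by simp
  then obtain k where "h = [:0, 1:] * k" by auto
  then have "f * k = 1" using h by (simp add: monom_altdef one_pCons)
  then show False using monic_irreduciblesD(1)[OF assms] by (metis dvd_triv_left irreducible_not_unit)
qed

lemma dvd_X_power_minus_1_imp_poly_0_nonzero:
  fixes f :: "'a :: field poly"
  assumes "f dvd monom 1 N - 1" "N > 0"
  shows "poly f 0 \<noteq> 0"
proof
  assume "poly f 0 = 0"
  moreover obtain h where "monom 1 N - 1 = f * h" using assms(1) by auto
  ultimately have "poly (monom 1 N - 1 :: 'a poly) 0 = 0" by simp
  then show False using assms(2) by (simp add: poly_monom zero_power)
qed

lemma monic_irreducible_divisors_X_power_minus_1: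
  fixes N :: nat
  assumes "N > 0"
  shows "{f :: 'a :: field poly. irreducible f \<and> lead_coeff f = 1 \<and> f dvd monom 1 N - 1} =
         {f \<in> monic_irreducibles. f dvd monom 1 N - 1}"
  using dvd_X_power_minus_1_imp_poly_0_nonzero[OF _ assms, where 'a = 'a]
  unfolding monic_irreducibles_def by blast

text \<open>The factor X of X^(q^n) - X is cancelled to apply \<open>dvd_X_power_card_iff\<close>.
  The exponent q^n - 1 is -1 in the field, so the polynomial is squarefree.\<close>

lemma degree_sum_card_power_minus_1:
  assumes "n > 0"
  defines "I \<equiv> {f :: 'a :: {finite, field} poly. f \<in> monic_irreducibles \<and> degree f dvd n}"
  shows "finite I" "(\<Sum>f\<in>I. degree f) = CARD('a) ^ n - 1"
proof -
  let ?q = "CARD('a)"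
  have qn: "?q ^ n > 1" using card_field_gt_1 assms(1) by (rule one_less_power)
  have "f dvd monom 1 (?q ^ n - 1) - 1 \<longleftrightarrow> degree f dvd n"
    if f: "f \<in> monic_irreducibles" for f :: "'a poly"
  proof -
    have "monom 1 (?q ^ n) - monom 1 1 = (monom 1 1 * (monom 1 (?q ^ n - 1) - 1) :: 'a poly)"
      by (simp add: right_diff_distrib mult_monom)
    then have "f dvd monom 1 (?q ^ n) - monom 1 1 \<longleftrightarrow> f dvd monom 1 (?q ^ n - 1) - 1"
      using monic_irreducible_not_dvd_monom[OF f, of 1] prime_elem_dvd_mult_iff[OF monic_irreduciblesD(2)[OF f]]
      by simp
    then show ?thesis using dvd_X_power_card_iff[OF monic_irreduciblesD(1)[OF f]] by simp
  qed
  then have I: "I = {f. irreducible f \<and> lead_coeff f = 1 \<and> f dvd monom 1 (?q ^ n - 1) - 1}"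
    using qn unfolding I_def by (subst monic_irreducible_divisors_X_power_minus_1) auto
  have "of_nat (?q ^ n - 1) + 1 = (of_nat (?q ^ n) :: 'a)"
    using qn by (metis Suc_pred' add.commute less_imp_le_nat less_le_trans of_nat_Suc zero_less_one)
  also have "\<dots> = 0" using assms(1) by (simp add: of_nat_card_field zero_power)
  finally have "of_nat (?q ^ n - 1) \<noteq> (0 :: 'a)" by (metis add_0 zero_neq_one)
  then show "finite I" "(\<Sum>f\<in>I. degree f) = ?q ^ n - 1"
    using qn degree_sum_divisors_X_power_minus_1[of "?q ^ n - 1", where 'a = 'a] unfolding I by auto
qed

text \<open>The exponent q^n + 1 equals 1 in the field, so this polynomial is squarefree as
  well.\<close>

lemma degree_sum_card_power_plus_1:
  assumes "n > 0"
  defines "I \<equiv> {f :: 'a :: {finite, field} poly. f \<in> monic_irreducibles \<and> f dvd monom 1 (CARD('a) ^ n + 1) - 1}"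
  shows "finite I" "(\<Sum>f\<in>I. degree f) = CARD('a) ^ n + 1"
proof -
  have "of_nat (CARD('a) ^ n + 1) \<noteq> (0 :: 'a)"
    using assms(1) by (simp add: of_nat_card_field zero_power)
  moreover have "I = {f. irreducible f \<and> lead_coeff f = 1 \<and> f dvd monom 1 (CARD('a) ^ n + 1) - 1}"
    unfolding I_def by (subst monic_irreducible_divisors_X_power_minus_1) auto
  ultimately show "finite I" "(\<Sum>f\<in>I. degree f) = CARD('a) ^ n + 1"
    using degree_sum_divisors_X_power_minus_1[of "CARD('a) ^ n + 1", where 'a = 'a] by auto
qed

section \<open>Monic reciprocals and the inverse of x modulo f\<close>

lemma degree_monic_reciprocal: "poly f 0 \<noteq> 0 \<Longrightarrow> degree (monic_reciprocal f) = degree f"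
  for f :: "'a :: field poly"
  by (simp add: monic_reciprocal_def poly_0_coeff_0)

lemma monic_reciprocal_involution:
  assumes "f \<in> monic_irreducibles"
  shows "monic_reciprocal (monic_reciprocal f) = f"
  using monic_irreduciblesD[OF assms]
  by (simp add: monic_reciprocal_def reflect_poly_smult)

text \<open>With nonzero constant terms, reflection is multiplicative, involutive and
  degree-preserving, so it carries factorisations to factorisations.\<close>

lemma irreducible_reflect_poly:
  fixes f :: "'a :: field poly"
  assumes "irreducible f" "coeff f 0 \<noteq> 0"
  shows "irreducible (reflect_poly f)"
proof (rule irreducibleI)
  fix a b assume ab: "reflect_poly f = a * b"
  have nz: "f \<noteq> 0" "a \<noteq> 0" "b \<noteq> 0" using assms(1) ab by (auto simp: irreducible_def)
  have "coeff (reflect_poly f) 0 \<noteq> 0" using nz by simp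
  then have a0: "coeff a 0 \<noteq> 0" "coeff b 0 \<noteq> 0" by (auto simp: ab coeff_mult)
  have "f = reflect_poly a * reflect_poly b"
    using assms(2) by (metis ab reflect_poly_mult reflect_poly_reflect_poly)
  then have "is_unit (reflect_poly a) \<or> is_unit (reflect_poly b)"
    using assms(1) by (rule irreducibleD[rotated])
  then show "is_unit a \<or> is_unit b"
    using a0 nz by (simp add: is_unit_iff_degree)
next
  show "reflect_poly f \<noteq> 0" using assms by auto
  then show "\<not> is_unit (reflect_poly f)"
    using assms degree_pos_if_irreducible[OF assms(1)] by (simp add: is_unit_iff_degree)
qed

lemma monic_reciprocal_in_monic_irreducibles:
  assumes "f \<in> monic_irreducibles"
  shows "monic_reciprocal f \<in> monic_irreducibles"
proof -
  note f = monic_irreduciblesD[OF assms]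
  have "irreducible (monic_reciprocal f)"
    unfolding monic_reciprocal_def using f by (intro irreducible_smultI irreducible_reflect_poly) auto
  moreover have "lead_coeff (monic_reciprocal f) = 1"
    using f by (simp add: monic_reciprocal_def coeff_reflect_poly poly_0_coeff_0)
  ultimately show ?thesis using f by (simp add: monic_irreducibles_def monic_reciprocal_def)
qed

text \<open>Here u plays the role of 1/x modulo f, and the claim is the congruence form of p*(x) =
  x^d p(1/x) with d the degree of p.\<close>

lemma dvd_reflect_poly_if_inverse:
  fixes f p :: "'a :: field poly"
  assumes "f dvd monom 1 1 * u - 1"
  shows "f dvd monom 1 (degree p) * pcompose p u - reflect_poly p"
proof (induction p)
  case (pCons a p)
  show ?case
  \<comment> \<open>For p = 0 the degree does not grow under \<open>pCons\<close>, so constants are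
    treated apart.\<close>
  proof (cases "p = 0")
    case False
    let ?d = "degree p"
    have "monom 1 (Suc ?d) = (monom 1 1 * monom 1 ?d :: 'a poly)" by (simp add: mult_monom)
    moreover have "monom a (Suc ?d) = monom 1 (Suc ?d) * [:a:]" by (simp add: smult_monom)
    ultimately have "monom 1 (degree (pCons a p)) * pcompose (pCons a p) u - reflect_poly (pCons a p) =
      (monom 1 1 * u - 1) * (monom 1 ?d * pcompose p u) + (monom 1 ?d * pcompose p u - reflect_poly p)"
      using False by (simp add: reflect_poly_pCons' pcompose_pCons algebra_simps)
    then show ?thesis using assms pCons.IH by (metis dvd_add dvd_mult2)
  qed (simp add: pcompose_pCons monom_1_0)
qed simp

text \<open>The hypothesis says that 1/x is x^(q^n) modulo f. This is a root of f by Frobenius, so f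
  divides its reflection, and two monic irreducibles dividing one another coincide.\<close>

lemma self_conjugate_if_dvd:
  fixes f :: "'a :: {finite, field} poly"
  assumes f: "f \<in> monic_irreducibles" and dvd: "f dvd monom 1 (CARD('a) ^ n + 1) - 1"
  shows "f = monic_reciprocal f"
proof -
  let ?u = "monom 1 (CARD('a) ^ n) :: 'a poly"
  have "monom 1 1 * ?u - 1 = monom 1 (CARD('a) ^ n + 1) - 1" by (simp add: mult_monom)
  then have "f dvd monom 1 (degree f) * pcompose f ?u - reflect_poly f"
    using dvd by (intro dvd_reflect_poly_if_inverse) simp
  moreover have "f dvd pcompose f ?u"
    unfolding frobenius_eq_pcompose[symmetric] by (simp add: dvd_power)
  then have "f dvd monom 1 (degree f) * pcompose f ?u" by (rule dvd_mult)
  ultimately have "f dvd reflect_poly f" by (metis dvd_diff_right_iff)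
  then have "f dvd monic_reciprocal f" by (simp add: monic_reciprocal_def dvd_smult)
  then show ?thesis
    using monic_irreduciblesD[OF f] monic_irreduciblesD[OF monic_reciprocal_in_monic_irreducibles[OF f]]
    by (intro monic_irreducible_dvd_eq) auto
qed

text \<open>The map x to x^(q^n) acts as inversion modulo f. Applied twice it fixes x, so f divides
  X^(q^(2n)) - X.\<close>

lemma degree_dvd_double_if_dvd:
  fixes f :: "'a :: {finite, field} poly"
  assumes f: "f \<in> monic_irreducibles" and dvd: "f dvd monom 1 (CARD('a) ^ n + 1) - 1"
  shows "degree f dvd 2 * n"
proof -
  let ?Q = "CARD('a) ^ n"
  have "f dvd (monom 1 (?Q + 1) - 1) ^ ?Q" using dvd by (simp add: dvd_power_le[of f _ 1 ?Q, simplified])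
  \<comment> \<open>With Q = q^n the difference expands to X^(Q^2 + Q) - X^(Q + 1) = X^Q (X^(Q^2) -
    X).\<close>
  then have "f dvd (monom 1 (?Q + 1) - 1) ^ ?Q - (monom 1 (?Q + 1) - 1)" using dvd by (rule dvd_diff)
  also have "(monom 1 (?Q + 1) - 1) ^ ?Q - (monom 1 (?Q + 1) - 1) =
             (monom 1 ?Q * (monom 1 (CARD('a) ^ (2 * n)) - monom 1 1) :: 'a poly)"
    by (simp add: frobenius_diff monom_1_power right_diff_distrib mult_monom algebra_simps mult_2_right power_add)
  finally have "f dvd monom 1 (CARD('a) ^ (2 * n)) - monom 1 1"
    using monic_irreducible_not_dvd_monom[OF f] prime_elem_dvd_mult_iff[OF monic_irreduciblesD(2)[OF f]] by blast
  then show ?thesis using dvd_X_power_card_iff[OF monic_irreduciblesD(1)[OF f]] by simp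
qed

text \<open>The \<open>q\<close>-power conjugates of \<open>x\<close> exhaust the roots of \<open>f\<close> modulo \<open>f\<close>, so the root
  \<open>1/x\<close> is one of them.\<close>

lemma self_conjugate_imp_dvd:
  fixes f :: "'a :: {finite, field} poly"
  assumes f: "f \<in> monic_irreducibles" and sc: "f = monic_reciprocal f"
  shows "\<exists>i<degree f. f dvd monom 1 (CARD('a) ^ i + 1) - 1"
proof (rule ccontr)
  assume *: "\<not> ?thesis"
  note fD = monic_irreduciblesD[OF f]
  let ?q = "CARD('a)" and ?m = "degree f"
  let ?x = "\<lambda>i. monom 1 (?q ^ i) :: 'a poly"
  have qm: "?q ^ ?m > 1" using card_field_gt_1 fD(6) by (rule one_less_power)
  \<comment> \<open>Since x^(q^m - 1) is 1 modulo f, this power is the inverse of x.\<close>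
  define v :: "'a poly" where "v = monom 1 (?q ^ ?m - 2)"
  have xv: "monom 1 1 * v = monom 1 (?q ^ ?m - 1)"
  proof -
    have "1 + (?q ^ ?m - 2) = ?q ^ ?m - 1" using qm by linarith
    then show ?thesis unfolding v_def mult_monom by (simp only: mult_1)
  qed
  have "monom 1 (?q ^ ?m) - monom 1 1 = (monom 1 1 * (monom 1 (?q ^ ?m - 1) - 1) :: 'a poly)"
    by (simp add: right_diff_distrib mult_monom)
  then have "f dvd monom 1 1 * (monom 1 (?q ^ ?m - 1) - 1)"
    using irreducible_dvd_X_power_card_degree[OF fD(1)] by simp
  then have inv: "f dvd monom 1 1 * v - 1"
    unfolding xv using monic_irreducible_not_dvd_monom[OF f] prime_elem_dvd_mult_iff[OF fD(2)] by blast
  have "reflect_poly f = smult (poly f 0) (monic_reciprocal f)"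
    using fD(4) by (simp add: monic_reciprocal_def)
  then have "f dvd reflect_poly f" by (metis sc dvd_refl dvd_smult)
  moreover have "f dvd monom 1 ?m * pcompose f v - reflect_poly f"
    by (rule dvd_reflect_poly_if_inverse[OF inv])
  ultimately have "f dvd monom 1 ?m * pcompose f v" by (metis dvd_diff_left_iff)
  then have fv: "f dvd pcompose f v"
    using monic_irreducible_not_dvd_monom[OF f] prime_elem_dvd_mult_iff[OF fD(2)] by blast
  have vx: "\<not> f dvd v - ?x i" if "i < ?m" for i
  proof
    assume "f dvd v - ?x i"
    then have "f dvd monom 1 1 * (v - ?x i)" by (rule dvd_mult)
    with inv have "f dvd (monom 1 1 * v - 1) - monom 1 1 * (v - ?x i)" by (rule dvd_diff)
    also have "\<dots> = monom 1 (?q ^ i + 1) - 1" by (simp add: right_diff_distrib mult_monom)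
    finally show False using * that by blast
  qed
  have xx: "\<not> f dvd ?x i - ?x j" if "i < ?m" "j < ?m" "i \<noteq> j" for i j
  proof -
    have "\<not> f dvd ?x j - ?x i" if "i < j" "j < ?m" for i j
      using dvd_X_power_card_diff_iff[OF fD(1), of i j] that nat_dvd_not_less[of "j - i" ?m] by auto
    from this[of i j] this[of j i] that show ?thesis by (metis dvd_diff_commute linorder_neqE_nat)
  qed
  have "inj_on ?x {..<?m}"
  proof (rule inj_onI)
    fix i j assume "i \<in> {..<?m}" "j \<in> {..<?m}" "?x i = ?x j"
    then show "i = j" using xx[of i j] by (cases "i = j") simp_all
  qed
  moreover have "v \<notin> ?x ` {..<?m}"
  proof
    assume "v \<in> ?x ` {..<?m}"
    then obtain i where "i < ?m" "v = ?x i" by auto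
    then show False using vx[of i] by simp
  qed
  ultimately have "card (insert v (?x ` {..<?m})) = Suc ?m" by (simp add: card_image)
  \<comment> \<open>The coefficients of f are read as constant polynomials, so that f can be
    evaluated at residues. Its m conjugate roots together with v would be m + 1 incongruent
    roots.\<close>
  moreover have "card (insert v (?x ` {..<?m})) \<le> degree (map_poly (\<lambda>a. [:a:]) f)"
  proof (rule card_roots_mod_prime_elem_le[OF fD(2)])
    show "\<not> f dvd lead_coeff (map_poly (\<lambda>a. [:a:]) f)"
      using fD(1,3) by (simp add: degree_map_poly coeff_map_poly irreducible_not_unit flip: one_pCons)
    show "f dvd poly (map_poly (\<lambda>a. [:a:]) f) a" if "a \<in> insert v (?x ` {..<?m})" for a
    proof -
      have "f dvd pcompose f (?x i)" for i
        unfolding frobenius_eq_pcompose[symmetric] by (simp add: dvd_power)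
      with that fv show ?thesis by (auto simp flip: pcompose_altdef)
    qed
    show "\<not> f dvd a - b" if "a \<in> insert v (?x ` {..<?m})" "b \<in> insert v (?x ` {..<?m})" "a \<noteq> b" for a b
      using that vx xx dvd_diff_commute[of f v] by (elim insertE imageE) auto
  qed simp
  ultimately show False by (simp add: degree_map_poly)
qed

text \<open>The index i from \<open>self_conjugate_imp_dvd\<close> is below the degree m, while m
  divides 2 i; hence i = 0 or m = 2 i. For i = 0, f divides X^2 - 1 and is linear.\<close>

lemma self_conjugate_cases:
  fixes f :: "'a :: {finite, field} poly"
  assumes f: "f \<in> monic_irreducibles" and sc: "f = monic_reciprocal f"
  obtains i where "f dvd monom 1 (CARD('a) ^ i + 1) - 1"
    "i = 0 \<and> degree f = 1 \<or> i > 0 \<and> degree f = 2 * i"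
proof -
  note fD = monic_irreduciblesD[OF f]
  obtain i where i: "i < degree f" "f dvd monom 1 (CARD('a) ^ i + 1) - 1"
    using self_conjugate_imp_dvd[OF f sc] by blast
  have "i = 0 \<and> degree f = 1 \<or> i > 0 \<and> degree f = 2 * i"
  proof (cases "i = 0")
    case True
    have "f dvd monom 1 2 - 1" using i(2) True by (simp add: numeral_2_eq_2)
    moreover have "monom 1 2 - 1 = [:1, 1:] * [:-1, 1 :: 'a:]"
      by (simp add: monom_altdef power2_eq_square one_pCons)
    ultimately have "f dvd [:1, 1:] \<or> f dvd [:-1, 1:]"
      using prime_elem_dvd_mult_iff[OF fD(2)] by metis
    then have "degree f \<le> 1"
      using dvd_imp_degree_le[of f "[:1, 1:]"] dvd_imp_degree_le[of f "[:-1, 1:]"] by auto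
    then show ?thesis using fD(6) True by simp
  next
    case False
    obtain c where c: "2 * i = degree f * c" using degree_dvd_double_if_dvd[OF f i(2)] by auto
    then have "degree f * c < degree f * 2" using i(1) by linarith
    then have "c < 2" by simp
    moreover have "c \<noteq> 0" using c False by (cases c) auto
    ultimately have "c = 1" by simp
    then show ?thesis using c False by simp
  qed
  with i(2) show ?thesis by (rule that)
qed

text \<open>With i from \<open>self_conjugate_cases\<close>, subtracting the two binomials and
  cancelling X turns the claim into divisibility of X^(q^n) - X^(q^i). For degree 2 i this means
  that n and i are congruent modulo 2 i, so that n is an odd multiple of i.\<close>

lemma dvd_X_power_card_plus_1_iff:
  fixes f :: "'a :: {finite, field} poly"
  assumes f: "f \<in> monic_irreducibles" and "n > 0"
  shows "f dvd monom 1 (CARD('a) ^ n + 1) - 1 \<longleftrightarrow>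
         f = monic_reciprocal f \<and> (degree f = 1 \<or> (\<exists>d>0. degree f = 2 * d \<and> d dvd n \<and> odd (n div d)))"
proof (cases "f = monic_reciprocal f")
  case False
  then show ?thesis using self_conjugate_if_dvd[OF f] by blast
next
  case sc: True
  note fD = monic_irreduciblesD[OF f]
  let ?q = "CARD('a)"
  obtain i where i: "f dvd monom 1 (?q ^ i + 1) - 1"
      "i = 0 \<and> degree f = 1 \<or> i > 0 \<and> degree f = 2 * i"
    using self_conjugate_cases[OF f sc] by blast
  have "f dvd monom 1 (?q ^ n + 1) - 1 \<longleftrightarrow>
        f dvd (monom 1 (?q ^ n + 1) - 1) - (monom 1 (?q ^ i + 1) - 1)"
    using i(1) by (metis dvd_diff_left_iff)
  also have "(monom 1 (?q ^ n + 1) - 1) - (monom 1 (?q ^ i + 1) - 1) =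
             (monom 1 1 * (monom 1 (?q ^ n) - monom 1 (?q ^ i)) :: 'a poly)"
    by (simp add: right_diff_distrib mult_monom)
  also have "f dvd \<dots> \<longleftrightarrow> f dvd monom 1 (?q ^ n) - monom 1 (?q ^ i)"
    using monic_irreducible_not_dvd_monom[OF f] prime_elem_dvd_mult_iff[OF fD(2)] by blast
  finally have eq: "f dvd monom 1 (?q ^ n + 1) - 1 \<longleftrightarrow> f dvd monom 1 (?q ^ n) - monom 1 (?q ^ i)" .
  show ?thesis
  proof (cases "i = 0")
    case True
    then have "degree f = 1" using i by simp
    moreover from this have "f dvd monom 1 (?q ^ n) - monom 1 (?q ^ i)"
      using dvd_X_power_card_diff_iff[OF fD(1), of i n] True by simp
    ultimately show ?thesis using eq sc by simp
  next
    case False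
    have m: "degree f = 2 * i" using i False by simp
    have "f dvd monom 1 (?q ^ n) - monom 1 (?q ^ i) \<longleftrightarrow> i dvd n \<and> odd (n div i)"
    proof (cases "i \<le> n")
      case True
      then obtain t where t: "n = i + t" using le_Suc_ex by blast
      have "2 * i dvd t \<longleftrightarrow> i dvd n \<and> odd (n div i)"
      proof (cases "i dvd t")
        case True
        then obtain k where "t = i * k" by auto
        moreover have "2 * i dvd i * k \<longleftrightarrow> even k"
          using False by (metis dvd_times_left_cancel_iff mult.commute)
        moreover have "(i + i * k) div i = Suc k" using False by simp
        ultimately show ?thesis using t by simp
      next
        case False
        then show ?thesis using t dvd_mult_right[of 2 i t] by (auto simp: dvd_add_right_iff)
      qed
      then show ?thesis using dvd_X_power_card_diff_iff[OF fD(1) True] m t by simp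
    next
      case le: False
      \<comment> \<open>For 0 < n < i both sides fail, since i - n lies strictly between 0 and 2
        i.\<close>
      have "f dvd monom 1 (?q ^ n) - monom 1 (?q ^ i) \<longleftrightarrow> 2 * i dvd i - n"
        using dvd_X_power_card_diff_iff[OF fD(1), of n i] m le dvd_diff_commute by (metis nat_le_linear)
      moreover have "\<not> 2 * i dvd i - n" using le \<open>n > 0\<close> by (intro nat_dvd_not_less) auto
      moreover have "\<not> i dvd n" using le \<open>n > 0\<close> by (intro nat_dvd_not_less) auto
      ultimately show ?thesis by simp
    qed
    moreover have "degree f \<noteq> 1" using m by auto
    ultimately show ?thesis using eq sc m False by auto
  qed
qed

text \<open>The point is that f(0) = 1. Evaluating f* = f(0) f at 1 gives this unless f(1) = 0,
  which would force f to be linear. In odd characteristic X - 1 is indeed its own monic reciprocal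
  without being self-reciprocal.\<close>

lemma self_reciprocal_iff_self_conjugate:
  fixes f :: "'a :: {finite, field} poly"
  assumes f: "f \<in> monic_irreducibles" and "degree f \<noteq> 1"
  shows "self_reciprocal f \<longleftrightarrow> f = monic_reciprocal f"
proof
  note fD = monic_irreduciblesD[OF f]
  assume "self_reciprocal f"
  then have "reflect_poly f = f" by (simp add: self_reciprocal_def)
  moreover from this have "poly f 0 = 1" using fD(3) by (metis poly_reflect_poly_0)
  ultimately show "f = monic_reciprocal f" by (simp add: monic_reciprocal_def)
next
  note fD = monic_irreduciblesD[OF f]
  assume "f = monic_reciprocal f"
  then have refl: "reflect_poly f = smult (poly f 0) f"
    using fD(4) by (metis monic_reciprocal_def right_inverse smult_1_left smult_smult)
  have "poly (reflect_poly f) 1 = poly f 1" by (simp add: poly_reflect_poly_nz)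
  then have "poly f 0 = 1 \<or> poly f 1 = 0" using refl by auto
  moreover have "poly f 1 \<noteq> 0"
  proof
    assume "poly f 1 = 0"
    then obtain h where h: "f = [:-1, 1:] * h" using poly_eq_0_iff_dvd by blast
    moreover have "\<not> is_unit [:-1, 1 :: 'a:]" by (simp add: is_unit_iff_degree)
    ultimately have "is_unit h" using fD(1) by (metis irreducible_def)
    then have "h \<noteq> 0 \<and> degree h = 0"  by (metis is_unit_iff_degree not_is_unit_0)
    then have "degree f = 1" unfolding h by (subst degree_mult_eq) auto
    with assms(2) show False by simp
  qed
  ultimately show "self_reciprocal f" using refl by (simp add: self_reciprocal_def)
qed

section \<open>Counting by conjugacy type\<close>

text \<open>The elements are X - 1 and X + 1, which coincide in characteristic 2. Naming the set
  lets its contribution cancel without being counted.\<close>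

definition self_conjugate_linear :: "'a :: field poly set" where
  "self_conjugate_linear = {f \<in> monic_irreducibles. degree f = 1 \<and> f = monic_reciprocal f}"

definition srim :: "nat \<Rightarrow> 'a :: field poly set" where
  "srim d = {f. irreducible f \<and> lead_coeff f = 1 \<and> degree f = 2 * d \<and> self_reciprocal f}"

definition non_self_conjugate :: "nat \<Rightarrow> 'a :: field poly set" where
  "non_self_conjugate d = {f \<in> monic_irreducibles. degree f = d \<and> f \<noteq> monic_reciprocal f}"

lemma finite_conjugacy_classes:
  "finite (self_conjugate_linear :: 'a :: {finite, field} poly set)"
  "finite (srim d :: 'a poly set)" "finite (non_self_conjugate d :: 'a poly set)"
  by (rule finite_subset[OF _ finite_polys_degree[of 1]],
      force simp: self_conjugate_linear_def,
      rule finite_subset[OF _ finite_polys_degree[of "2 * d"]], force simp: srim_def,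
      rule finite_subset[OF _ finite_polys_degree[of d]], force simp: non_self_conjugate_def)

lemma srim_iff:
  fixes f :: "'a :: {finite, field} poly"
  shows "f \<in> srim d \<longleftrightarrow> f \<in> monic_irreducibles \<and> degree f = 2 * d \<and> f = monic_reciprocal f"
proof (cases "f \<in> monic_irreducibles \<and> degree f = 2 * d")
  case True
  then have "self_reciprocal f \<longleftrightarrow> f = monic_reciprocal f"
    by (intro self_reciprocal_iff_self_conjugate) auto
  with True show ?thesis by (auto simp: srim_def monic_irreducibles_def)
next
  case False
  then show ?thesis by (auto simp: srim_def monic_irreducibles_def self_reciprocal_def)
qed

text \<open>The involution \<open>monic_reciprocal\<close> has no fixed point here, so its orbits
  are blocks of size two.\<close>

lemma card_non_self_conjugate:
  "card (non_self_conjugate d :: 'a :: {finite, field} poly set) = 2 * SRIM_plus TYPE('a) d"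
proof -
  let ?A = "non_self_conjugate d :: 'a poly set"
  let ?C = "(\<lambda>f. {f, monic_reciprocal f}) ` ?A"
  have closed: "monic_reciprocal f \<in> ?A" if "f \<in> ?A" for f
    using that monic_reciprocal_in_monic_irreducibles[of f] monic_reciprocal_involution[of f]
      degree_monic_reciprocal[of f]
    by (auto simp: non_self_conjugate_def dest: monic_irreduciblesD)
  have inv: "monic_reciprocal (monic_reciprocal f) = f" if "f \<in> ?A" for f
    using that monic_reciprocal_involution[of f] by (auto simp: non_self_conjugate_def)
  have "2 * card ?C = card (\<Union>?C)"
  proof (rule card_partition)
    show "finite ?C" "finite (\<Union>?C)" by (auto intro: finite_conjugacy_classes)
    show "card c = 2" if "c \<in> ?C" for c
      using that by (auto simp: non_self_conjugate_def)
    show "c1 \<inter> c2 = {}" if c: "c1 \<in> ?C" "c2 \<in> ?C" "c1 \<noteq> c2" for c1 c2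
    proof (rule ccontr)
      assume ne: "c1 \<inter> c2 \<noteq> {}"
      have same: "{f, monic_reciprocal f} = {g, monic_reciprocal g}"
        if "f \<in> ?A" "g \<in> {f, monic_reciprocal f}" for f g
        using that inv[of f] by auto
      obtain f g h where "f \<in> ?A" "g \<in> ?A" "c1 = {f, monic_reciprocal f}" "c2 = {g, monic_reciprocal g}"
        "h \<in> c1" "h \<in> c2" using c ne by blast
      then have "c1 = {h, monic_reciprocal h}" "c2 = {h, monic_reciprocal h}"
        using same[of f h] same[of g h] by auto
      with c(3) show False by simp
    qed
  qed
  moreover have "\<Union>?C = ?A" using closed by auto
  moreover have "?C = {{f, monic_reciprocal f} | f :: 'a poly. irreducible f \<and> lead_coeff f = 1 \<and>
      degree f = d \<and> poly f 0 \<noteq> 0 \<and> f \<noteq> monic_reciprocal f}"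
    by (auto simp: non_self_conjugate_def monic_irreducibles_def)
  ultimately show ?thesis by (simp add: SRIM_plus_def)
qed

lemma card_srim: "card (srim d :: 'a :: {finite, field} poly set) = SRIM_minus TYPE('a) d"
  by (simp add: srim_def SRIM_minus_def)

section \<open>Degree sums and the divisor identity\<close>

lemma degree_sum_srim_UN:
  assumes "finite D"
  shows "(\<Sum>f\<in>(\<Union>d\<in>D. srim d :: 'a :: {finite, field} poly set). degree f) =
         (\<Sum>d\<in>D. 2 * d * SRIM_minus TYPE('a) d)"
proof -
  have "(\<Sum>f\<in>(\<Union>d\<in>D. srim d :: 'a poly set). degree f) = (\<Sum>d\<in>D. \<Sum>f\<in>(srim d :: 'a poly set). degree f)"
    using assms by (intro sum.UNION_disjoint) (auto simp: finite_conjugacy_classes, auto simp: srim_def)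
  also have "\<dots> = (\<Sum>d\<in>D. 2 * d * SRIM_minus TYPE('a) d)"
  proof (rule sum.cong[OF refl])
    fix d
    have "(\<Sum>f\<in>(srim d :: 'a poly set). degree f) = (\<Sum>f\<in>(srim d :: 'a poly set). 2 * d)"
      by (rule sum.cong) (auto simp: srim_def)
    then show "(\<Sum>f\<in>(srim d :: 'a poly set). degree f) = 2 * d * SRIM_minus TYPE('a) d"
      by (simp add: card_srim)
  qed
  finally show ?thesis .
qed

text \<open>The factor 2 counts the members of a pair, whereas in \<open>degree_sum_srim_UN\<close>
  it comes from the degree 2 d.\<close>

lemma degree_sum_non_self_conjugate_UN:
  assumes "finite D"
  shows "(\<Sum>f\<in>(\<Union>d\<in>D. non_self_conjugate d :: 'a :: {finite, field} poly set). degree f) =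
         (\<Sum>d\<in>D. 2 * d * SRIM_plus TYPE('a) d)"
proof -
  have "(\<Sum>f\<in>(\<Union>d\<in>D. non_self_conjugate d :: 'a poly set). degree f) =
        (\<Sum>d\<in>D. \<Sum>f\<in>(non_self_conjugate d :: 'a poly set). degree f)"
    using assms by (intro sum.UNION_disjoint) (auto simp: finite_conjugacy_classes, auto simp: non_self_conjugate_def)
  also have "\<dots> = (\<Sum>d\<in>D. 2 * d * SRIM_plus TYPE('a) d)"
  proof (rule sum.cong[OF refl])
    fix d
    have "(\<Sum>f\<in>(non_self_conjugate d :: 'a poly set). degree f) =
          (\<Sum>f\<in>(non_self_conjugate d :: 'a poly set). d)"
      by (rule sum.cong) (auto simp: non_self_conjugate_def)
    then show "(\<Sum>f\<in>(non_self_conjugate d :: 'a poly set). degree f) = 2 * d * SRIM_plus TYPE('a) d"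
      by (simp add: card_non_self_conjugate)
  qed
  finally show ?thesis .
qed

text \<open>This is the coefficient identity for the logarithmic derivatives, with \<epsilon>
  divided out. The two degree sums differ by 2, the linear terms cancel, and every remaining term
  carries a factor 2.\<close>

lemma SRIM_divisor_sum:
  assumes n: "n > 0"
  defines "D \<equiv> {d. d dvd n}"
  shows "(\<Sum>d\<in>D. int d * (- ((-1) ^ (n div d)) * int (SRIM_minus TYPE('a :: {finite, field}) d)
            - int (SRIM_plus TYPE('a) d))) = 1"
proof -
  let ?L = "self_conjugate_linear :: 'a poly set"
  let ?S = "\<lambda>d. srim d :: 'a poly set" and ?P = "\<lambda>d. non_self_conjugate d :: 'a poly set"
  let ?Nm = "SRIM_minus TYPE('a)" and ?Np = "SRIM_plus TYPE('a)"
  \<comment> \<open>An element of \<open>srim d\<close> divides X^(q^n - 1) - 1 iff d is in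
    \<open>De\<close>, and X^(q^n + 1) - 1 iff d is in \<open>Do\<close>.\<close>
  define De where "De = {d \<in> D. even (n div d)}"
  define Do where "Do = {d \<in> D. odd (n div d)}"
  have fin: "finite D" "finite De" "finite Do" using n by (auto simp: D_def De_def Do_def)
  have De: "d \<in> De \<longleftrightarrow> 2 * d dvd n" for d
    using n by (auto simp: De_def D_def elim!: dvdE)
  have sumL: "(\<Sum>f\<in>?L. degree f) = card ?L" by (simp add: self_conjugate_linear_def)

  have sum1: "CARD('a) ^ n - 1 = card ?L + (\<Sum>d\<in>D. 2 * d * ?Np d) + (\<Sum>d\<in>De. 2 * d * ?Nm d)"
  proof -
    have "{f :: 'a poly. f \<in> monic_irreducibles \<and> degree f dvd n} =
          (?L \<union> (\<Union>d\<in>D. ?P d)) \<union> (\<Union>d\<in>De. ?S d)" (is "?I = _")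
    proof (intro equalityI subsetI)
      fix f :: "'a poly" assume f: "f \<in> ?I"
      show "f \<in> (?L \<union> (\<Union>d\<in>D. ?P d)) \<union> (\<Union>d\<in>De. ?S d)"
      proof (cases "f = monic_reciprocal f")
        case False
        then show ?thesis using f by (auto simp: non_self_conjugate_def D_def)
      next
        case True
        from f have "f \<in> monic_irreducibles" by simp
        then obtain i where "i = 0 \<and> degree f = 1 \<or> i > 0 \<and> degree f = 2 * i"
          using self_conjugate_cases True by blast
        then show ?thesis using f True by (auto simp: self_conjugate_linear_def srim_iff De)
      qed
    next
      fix f assume "f \<in> (?L \<union> (\<Union>d\<in>D. ?P d)) \<union> (\<Union>d\<in>De. ?S d)"
      then show "f \<in> ?I"
        by (auto simp: self_conjugate_linear_def srim_iff De non_self_conjugate_def D_def)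
    qed
    moreover have "(\<Sum>f\<in>?L \<union> (\<Union>d\<in>D. ?P d) \<union> (\<Union>d\<in>De. ?S d). degree f) =
        card ?L + (\<Sum>d\<in>D. 2 * d * ?Np d) + (\<Sum>d\<in>De. 2 * d * ?Nm d)"
    proof -
      have d1: "?L \<inter> (\<Union>d\<in>D. ?P d) = {}"
        by (auto simp: self_conjugate_linear_def non_self_conjugate_def)
      have d2: "(?L \<union> (\<Union>d\<in>D. ?P d)) \<inter> (\<Union>d\<in>De. ?S d) = {}"
        by (auto simp: self_conjugate_linear_def non_self_conjugate_def srim_iff)
      show ?thesis
        using fin by (simp add: sum.union_disjoint d1 d2 finite_conjugacy_classes sumL degree_sum_srim_UN
            degree_sum_non_self_conjugate_UN)
    qed
    ultimately show ?thesis using degree_sum_card_power_minus_1(2)[OF n, where 'a = 'a] by simp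
  qed

  have sum2: "CARD('a) ^ n + 1 = card ?L + (\<Sum>d\<in>Do. 2 * d * ?Nm d)"
  proof -
    have "{f :: 'a poly. f \<in> monic_irreducibles \<and> f dvd monom 1 (CARD('a) ^ n + 1) - 1} =
          ?L \<union> (\<Union>d\<in>Do. ?S d)" (is "?I = _")
    proof (intro equalityI subsetI)
      fix f :: "'a poly" assume "f \<in> ?I"
      then have f: "f \<in> monic_irreducibles" "f dvd monom 1 (CARD('a) ^ n + 1) - 1" by auto
      then show "f \<in> ?L \<union> (\<Union>d\<in>Do. ?S d)"
        using dvd_X_power_card_plus_1_iff[OF f(1) n]
        by (auto simp: self_conjugate_linear_def srim_iff Do_def D_def)
    next
      fix f :: "'a poly" assume f: "f \<in> ?L \<union> (\<Union>d\<in>Do. ?S d)"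
      then have m: "f \<in> monic_irreducibles" by (auto simp: self_conjugate_linear_def srim_iff)
      show "f \<in> ?I"
        using f n m dvd_X_power_card_plus_1_iff[OF m n] monic_irreduciblesD(6)[OF m]
        by (auto simp: self_conjugate_linear_def srim_iff Do_def D_def)
    qed
    moreover have "?L \<inter> (\<Union>d\<in>Do. ?S d) = {}"
      by (auto simp: self_conjugate_linear_def srim_iff)
    then have "(\<Sum>f\<in>?L \<union> (\<Union>d\<in>Do. ?S d). degree f) = card ?L + (\<Sum>d\<in>Do. 2 * d * ?Nm d)"
      using fin by (simp add: sum.union_disjoint finite_conjugacy_classes sumL degree_sum_srim_UN)
    ultimately show ?thesis using degree_sum_card_power_plus_1(2)[OF n, where 'a = 'a] by simp
  qed

  \<comment> \<open>Positivity ensures that the natural-number subtraction in \<open>sum1\<close> is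
    not truncated.\<close>
  have "CARD('a) ^ n > 0" by simp
  then have "(\<Sum>d\<in>Do. 2 * d * ?Nm d) = (\<Sum>d\<in>D. 2 * d * ?Np d) + (\<Sum>d\<in>De. 2 * d * ?Nm d) + 2"
    using sum1 sum2 by linarith
  then have "int (\<Sum>d\<in>Do. 2 * (d * ?Nm d)) =
      int ((\<Sum>d\<in>D. 2 * (d * ?Np d)) + (\<Sum>d\<in>De. 2 * (d * ?Nm d)) + 2)"
    by (simp only: mult.assoc)
  then have key: "(\<Sum>d\<in>Do. int d * int (?Nm d)) - (\<Sum>d\<in>De. int d * int (?Nm d)) - (\<Sum>d\<in>D. int d * int (?Np d)) = 1"
    by (simp flip: sum_distrib_left)
  have "D = Do \<union> De" "Do \<inter> De = {}" by (auto simp: Do_def De_def)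
  then have "(\<Sum>d\<in>D. int d * (- ((-1) ^ (n div d)) * int (?Nm d))) =
      (\<Sum>d\<in>Do. int d * (- ((-1) ^ (n div d)) * int (?Nm d))) + (\<Sum>d\<in>De. int d * (- ((-1) ^ (n div d)) * int (?Nm d)))"
    using fin by (simp only: sum.union_disjoint)
  also have "\<dots> = (\<Sum>d\<in>Do. int d * int (?Nm d)) + (\<Sum>d\<in>De. - (int d * int (?Nm d)))"
    by (intro arg_cong2[where f = "(+)"] sum.cong) (auto simp: Do_def De_def)
  finally show ?thesis using key
    by (simp add: right_diff_distrib sum_subtractf sum_negf)
qed

section \<open>Assembly of the power series identity\<close>

text \<open>The separate summand 1 agrees with the coefficient at 0 of the product, because the only
  partition of 0 is empty.\<close>

lemma partition_series_nth:
  assumes w: "\<And>d k. w d k = s ^ k * (c d gchoose k)" and "n \<le> K"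
  shows "(1 + Abs_fps (\<lambda>n. if n \<ge> 1 then
            (\<Sum>\<mu>\<in>partitions_of n. \<Prod>d\<in>set_mset \<mu>. w d (count \<mu> d)) else 0)) $ n =
         (\<Prod>d=1..K. binomial_factor s (c d) d) $ n"
proof -
  have prod: "(\<Sum>\<mu>\<in>partitions_of n. \<Prod>d\<in>set_mset \<mu>. w d (count \<mu> d)) =
        (\<Prod>d=1..K. binomial_factor s (c d) d) $ n"
    unfolding binomial_factor_def w[symmetric]
    by (rule partition_sum_eq_fps_prod_nth) (use assms in simp_all)
  show ?thesis
  proof (cases "n = 0")
    case True
    have "partitions_of 0 = {{#}}"
      by (auto simp: partitions_of_def) (metis all_not_in_conv gr0I set_mset_eq_empty_iff)
    with True prod show ?thesis by simp
  next
    case False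
    with prod show ?thesis by simp
  qed
qed

theorem theorem6p6:
  fixes \<epsilon> :: int
  assumes "\<epsilon> \<in> {-1, 1}"
  shows
    "(1 + Abs_fps (\<lambda>n. if n \<ge> 1 then
         (\<Sum>\<mu>\<in>partitions_of n. \<Prod>d\<in>set_mset \<mu>.
            int_binomial (of_int \<epsilon> * of_nat (SRIM_minus TYPE('a :: {finite, field}) d))
              (int (count \<mu> d))) else 0)) *
     (1 + Abs_fps (\<lambda>n. if n \<ge> 1 then
         (\<Sum>\<mu>\<in>partitions_of n. \<Prod>d\<in>set_mset \<mu>.
            int_binomial (of_int \<epsilon> * of_nat (SRIM_plus TYPE('a) d))
              (- int (count \<mu> d))) else 0))
     = (1 / (1 - fps_X)) powi \<epsilon>"
    (is "?A * ?B = ?H")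
proof (rule fps_ext)
  fix n
  let ?cm = "\<lambda>d. of_int \<epsilon> * of_nat (SRIM_minus TYPE('a) d) :: rat"
  let ?cp = "\<lambda>d. of_int \<epsilon> * of_nat (SRIM_plus TYPE('a) d) :: rat"
  \<comment> \<open>Both products are cut off at n, the coefficient under comparison; larger d
    affect only higher coefficients.\<close>
  define P where "P = (\<Prod>d=1..n. binomial_factor 1 (?cm d) d)"
  define Q where "Q = (\<Prod>d=1..n. binomial_factor (-1) (?cp d) d)"
  define L where "L = (\<Sum>d=1..n. binomial_logderiv 1 (?cm d) d) + (\<Sum>d=1..n. binomial_logderiv (-1) (?cp d) d)"
  have A: "?A $ i = P $ i" if "i \<le> n" for i
    unfolding P_def by (rule partition_series_nth) (use that in \<open>auto simp: int_binomial_def\<close>)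
  \<comment> \<open>For lower index -k the binomial is (-1)^k times the ordinary one, hence s = -1.
    At k = 0 the nonnegative branch gives the same value 1.\<close>
  have B: "?B $ i = Q $ i" if "i \<le> n" for i
    unfolding Q_def by (rule partition_series_nth) (use that in \<open>auto simp: int_binomial_def\<close>)
  have "(?A * ?B) $ n = (P * Q) $ n"
    unfolding fps_mult_nth by (intro sum.cong refl arg_cong2[where f = "(*)"] A B) auto
  also have "\<dots> = ?H $ n"
  proof (rule fps_nth_eq_if_same_logderiv)
    have "fps_XD P = P * (\<Sum>d=1..n. binomial_logderiv 1 (?cm d) d)"
      unfolding P_def by (rule XD_prod_logderiv) (simp add: XD_binomial_factor)
    moreover have "fps_XD Q = Q * (\<Sum>d=1..n. binomial_logderiv (-1) (?cp d) d)"
      unfolding Q_def by (rule XD_prod_logderiv) (simp add: XD_binomial_factor)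
    ultimately show "fps_XD (P * Q) = P * Q * L"
      unfolding XD_mult L_def by (simp add: algebra_simps)
    show "fps_XD ?H = ?H * Abs_fps (\<lambda>n. if n > 0 then of_int \<epsilon> else 0)"
      by (rule XD_geometric_powi(1)[OF assms])
    show "(P * Q) $ 0 = ?H $ 0"
      using A[of 0] B[of 0] XD_geometric_powi(2)[OF assms] by simp
    show L0: "L $ 0 = 0" by (simp add: L_def fps_sum_nth binomial_logderiv_def)
    show "L $ i = Abs_fps (\<lambda>n. if n > 0 then of_int \<epsilon> else 0) $ i" if i: "i \<le> n" for i
    proof (cases "i = 0")
      case True
      then show ?thesis using L0 by simp
    next
      case False
      let ?t = "\<lambda>d. int d * (- ((-1) ^ (i div d)) * int (SRIM_minus TYPE('a) d) - int (SRIM_plus TYPE('a) d))"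
      \<comment> \<open>The factor -(-s)^(i/d) is -(-1)^(i/d) for s = 1 and -1 for s = -1, which
        produces the two signs of the divisor identity.\<close>
      have "L $ i = (\<Sum>d=1..n. if d dvd i then of_int (\<epsilon> * ?t d) else 0)"
        unfolding L_def sum.distrib[symmetric] fps_sum_nth
        by (rule sum.cong) (use False in \<open>auto simp: binomial_logderiv_def algebra_simps\<close>)
      also have "\<dots> = (\<Sum>d | d dvd i. of_int (\<epsilon> * ?t d))"
      proof (rule sum.mono_neutral_cong_right)
        show "{d. d dvd i} \<subseteq> {1..n}"
        proof
          fix d assume "d \<in> {d. d dvd i}"
          then have "d \<noteq> 0" "d \<le> i" using False by (auto dest: dvd_imp_le)
          then show "d \<in> {1..n}" using i by simp
        qed
      qed auto
      also have "\<dots> = of_int (\<epsilon> * (\<Sum>d | d dvd i. ?t d))"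
        by (simp only: of_int_sum sum_distrib_left)
      also have "\<dots> = of_int \<epsilon>" using SRIM_divisor_sum[of i, where 'a = 'a] False by simp
      finally show ?thesis using False by simp
    qed
  qed simp
  finally show "(?A * ?B) $ n = ?H $ n" .
qed

end
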